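(* There is a constant $c$ such that for every graph $G$, $\mathrm{tw}(G)\leq c\,\Delta(G)^4\,\mathrm{stw}(G)^2\log|V(G)|$, where $\mathrm{tw}$ is treewidth and $\Delta$ is maximum degree.
   Context: All graphs are finite and simple. A partition sequence of an $n$-vertex graph $G$ is a sequence $\mathcal P_n,\dots,\mathcal P_1$ of partitions of $V(G)$ such that $\mathcal P_n$ is the partition into singletons, $\mathcal P_1=\{V(G)\}$, and each $\mathcal P_i$ ($i<n$) is obtained from $\mathcal P_{i+1}$ by merging two parts. Two distinct parts $X,Y$ are inhomogeneous if there are $u,u'\in X$, $v,v'\in Y$ with $uv\in E(G)$, $u'v'\notin E(G)$. The red graph $\mathcal R(\mathcal P)$ has vertex set $\mathcal P$ and edges between inhomogeneous parts. For a total order $\prec$ on $V(G)$ and $X\subseteq V(G)$, the span $\langle X\rangle=\{v:\min X\preceq v\preceq\max X\}$; $X,Y$ conflict if their spans intersect. For $X\in\mathcal P$, a part $Y\in\mathcal P\setminus\{X\}$ interferes with $X$ if $Y$ conflicts with the union of the parts in the closed neighborhood of $X$ in $\mathcal R(\mathcal P)$; the stretch of $X$ is the number of parts interfering with $X$; the stretch of $\mathcal P$ is the maximum stretch of a part. $\mathrm{stw}(G,\prec)$ is the minimum over partition sequences of the maximum stretch of its partitions, and $\mathrm{stw}(G)=\min_\prec \mathrm{stw}(G,\prec)$.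
   Formalization: stw(G) is replaced by max(1, stw(G)), since with the given definition stw(K_2) = 0 while tw(K_2) = 1, so the literal inequality fails; graphs are nonempty, with natural numbers as vertices. *)

theory Defs
  imports
    Complex_Main
    "HOL-Library.Disjoint_Sets"
    "Graph_Theory.Pair_Digraph"
    "Graph_Theory.Digraph_Component"
begin

text \<open>A finite simple graph is a \<^locale>\<open>pair_graph\<close>: a finite, loop-free, symmetric digraph
  whose arcs are pairs of vertices. An edge $uv$ is the pair of arcs $(u,v)$, $(v,u)$, so the
  degree of a vertex is its out-degree.\<close>

definition max_degree :: "'a pair_pre_digraph \<Rightarrow> nat" where
  "max_degree G = Max (out_degree (with_proj G) ` pverts G)"


section \<open>Treewidth\<close>

text \<open>The library's \<^const>\<open>tree\<close> is not usable here: in a symmetric digraph each edge is a directed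
  cycle of length 2, which is why only cycles of length at least 3 are excluded. The constant
  \<open>Digraph_Component.connected\<close> includes nonemptiness.\<close>

definition undirected_tree :: "'t pair_pre_digraph \<Rightarrow> bool" where
  "undirected_tree T \<longleftrightarrow>
     pair_graph T \<and> Digraph_Component.connected (with_proj T) \<and>
     \<not> (\<exists>p. pre_digraph.cycle (with_proj T) p \<and> 3 \<le> length p)"

definition tree_decomposition ::
    "'a pair_pre_digraph \<Rightarrow> 't pair_pre_digraph \<Rightarrow> ('t \<Rightarrow> 'a set) \<Rightarrow> bool" where
  "tree_decomposition G T bag \<longleftrightarrow>
     undirected_tree T \<and>
     (\<Union>t\<in>pverts T. bag t) = pverts G \<and>
     (\<forall>(u, v)\<in>parcs G. \<exists>t\<in>pverts T. u \<in> bag t \<and> v \<in> bag t) \<and>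
     (\<forall>v\<in>pverts G.
        Digraph_Component.connected (with_proj T \<restriction> {t \<in> pverts T. v \<in> bag t}))"

definition decomposition_width :: "'t pair_pre_digraph \<Rightarrow> ('t \<Rightarrow> 'a set) \<Rightarrow> nat" where
  "decomposition_width T bag = Max ((\<lambda>t. card (bag t)) ` pverts T) - 1"

text \<open>Decomposition trees are finite, so taking their nodes in \<^typ>\<open>nat\<close> loses no generality.
  Here and below, \<^const>\<open>Inf\<close> of a nonempty set of natural numbers is its minimum.\<close>

definition treewidth :: "'a pair_pre_digraph \<Rightarrow> nat" where
  "treewidth G =
     Inf {decomposition_width T bag | (T :: nat pair_pre_digraph) bag. tree_decomposition G T bag}"


section \<open>Stretch-width\<close>

definition partition_sequence :: "'a pair_pre_digraph \<Rightarrow> (nat \<Rightarrow> 'a set set) \<Rightarrow> bool" where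
  "partition_sequence G \<P> \<longleftrightarrow>
     (let n = card (pverts G) in
       (\<forall>i\<in>{1..n}. partition_on (pverts G) (\<P> i)) \<and>
       \<P> n = (\<lambda>v. {v}) ` pverts G \<and>
       \<P> 1 = {pverts G} \<and>
       (\<forall>i\<in>{1..<n}. \<exists>X\<in>\<P> (Suc i). \<exists>Y\<in>\<P> (Suc i).
          X \<noteq> Y \<and> \<P> i = \<P> (Suc i) - {X, Y} \<union> {X \<union> Y}))"

definition inhomogeneous :: "'a pair_pre_digraph \<Rightarrow> 'a set \<Rightarrow> 'a set \<Rightarrow> bool" where
  "inhomogeneous G X Y \<longleftrightarrow>
     X \<noteq> Y \<and> (\<exists>u\<in>X. \<exists>v\<in>Y. (u, v) \<in> parcs G) \<and> (\<exists>u'\<in>X. \<exists>v'\<in>Y. (u', v') \<notin> parcs G)"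

definition red_graph :: "'a pair_pre_digraph \<Rightarrow> 'a set set \<Rightarrow> 'a set pair_pre_digraph" where
  "red_graph G P = \<lparr> pverts = P, parcs = {(X, Y). X \<in> P \<and> Y \<in> P \<and> inhomogeneous G X Y} \<rparr>"

definition closed_neighborhood :: "'a pair_pre_digraph \<Rightarrow> 'a \<Rightarrow> 'a set" where
  "closed_neighborhood H x = insert x {y. (x, y) \<in> parcs H}"

text \<open>A total order on the vertices is a relation \<open>r\<close> with \<open>linear_order_on (pverts G) r\<close>, where
  \<open>(u, v) \<in> r\<close> means $u \preceq v$. In the next definition \<open>a\<close> and \<open>b\<close> are the minimum and the
  maximum of \<open>X\<close>; the span of the empty set is empty.\<close>

definition order_span :: "'a rel \<Rightarrow> 'a set \<Rightarrow> 'a set" where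
  "order_span r X = {v. \<exists>a\<in>X. \<exists>b\<in>X. (\<forall>x\<in>X. (a, x) \<in> r \<and> (x, b) \<in> r) \<and> (a, v) \<in> r \<and> (v, b) \<in> r}"

definition conflict :: "'a rel \<Rightarrow> 'a set \<Rightarrow> 'a set \<Rightarrow> bool" where
  "conflict r X Y \<longleftrightarrow> order_span r X \<inter> order_span r Y \<noteq> {}"

definition interferes ::
    "'a pair_pre_digraph \<Rightarrow> 'a rel \<Rightarrow> 'a set set \<Rightarrow> 'a set \<Rightarrow> 'a set \<Rightarrow> bool" where
  "interferes G r P Y X \<longleftrightarrow>
     Y \<in> P - {X} \<and> conflict r Y (\<Union> (closed_neighborhood (red_graph G P) X))"

definition part_stretch ::
    "'a pair_pre_digraph \<Rightarrow> 'a rel \<Rightarrow> 'a set set \<Rightarrow> 'a set \<Rightarrow> nat" where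
  "part_stretch G r P X = card {Y. interferes G r P Y X}"

definition partition_stretch :: "'a pair_pre_digraph \<Rightarrow> 'a rel \<Rightarrow> 'a set set \<Rightarrow> nat" where
  "partition_stretch G r P = Max (part_stretch G r P ` P)"

definition ordered_stretch_width :: "'a pair_pre_digraph \<Rightarrow> 'a rel \<Rightarrow> nat" where
  "ordered_stretch_width G r =
     Inf {Max ((\<lambda>i. partition_stretch G r (\<P> i)) ` {1..card (pverts G)}) | \<P>.
            partition_sequence G \<P>}"

text \<open>Since a part does not interfere with itself, the stretch-width can be 0 for a graph with edges:
  it is 0 for every complete graph. A bound on treewidth that has the stretch-width as a factor
  therefore only makes sense with \<open>max 1 (stretch_width G)\<close> in its place.\<close>

definition stretch_width :: "'a pair_pre_digraph \<Rightarrow> nat" where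
  "stretch_width G = Inf {ordered_stretch_width G r | r. linear_order_on (pverts G) r}"

end

theory Submission
  imports Defs
begin

text \<open>Write $\Delta$ for the maximum degree, $t$ for the stretch-width, and lay the vertices out in an
  optimal order, viewed as a circle. For four consecutive arcs $P, Q, R, T$ of the circle, the edges
  between $P$ and $R$ cross those between $Q$ and $T$, and one of the two sets has fewer than
  $m = 2\Delta^2(t+1)+1$ edges: otherwise consider the first partition in which some part contains
  more than $\Delta$ ends of these edges in one arc.

  Now let $W$ be a set of vertices, and cut the circle into four arcs with a quarter of $W$ each.
  One pair of opposite arcs, say $A$ and $B$, has fewer than $m$ edges between them. Shrink each of
  the other two arcs to a point by bisection: giving either half to the neighbouring arc adds one of two
  crossing edge sets to the cut, so each step costs at most $m$ for the right choice. This gives a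
  chord of the circle crossed by $O(m \log n)$ edges with a quarter of $W$ on either side. Applied
  recursively to the boundary of the current vertex set, such cuts keep all boundaries of size
  $O(m \log n)$, and the boundaries are the bags of a tree decomposition.\<close>

section \<open>Trees given by parent pointers\<close>

text \<open>The lemmas assume \<open>p i < i\<close> for positive \<open>i\<close>. Then
  \<open>0\<close> is the root, and acyclicity and connectivity reduce to comparing node
  numbers.\<close>

definition parent_tree :: "nat \<Rightarrow> (nat \<Rightarrow> nat) \<Rightarrow> nat pair_pre_digraph" where
  "parent_tree N p =
     \<lparr> pverts = {..<N}, parcs = {(i, j). i < N \<and> j < N \<and> (0 < i \<and> j = p i \<or> 0 < j \<and> i = p j)} \<rparr>"

lemma pair_graph_parent_tree:
  assumes "\<And>i. \<lbrakk>0 < i; i < N\<rbrakk> \<Longrightarrow> p i < i"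
  shows "pair_graph (parent_tree N p)"
proof
  have "parcs (parent_tree N p) \<subseteq> {..<N} \<times> {..<N}"
    by (auto simp: parent_tree_def)
  then show "finite (parcs (parent_tree N p))"
    by (rule finite_subset) auto
  show "symmetric (with_proj (parent_tree N p))"
    by (auto simp: symmetric_def sym_def parent_tree_def)
next
  fix e assume "e \<in> parcs (parent_tree N p)"
  then show "fst e \<noteq> snd e"
    using assms[of "fst e"] assms[of "snd e"] by (cases e) (auto simp: parent_tree_def)
qed (auto simp: parent_tree_def)

lemma pcas_nth:
  assumes "pcas u es v"
  shows "(es \<noteq> [] \<longrightarrow> fst (es ! 0) = u \<and> snd (es ! (length es - 1)) = v)
    \<and> (\<forall>j. Suc j < length es \<longrightarrow> fst (es ! Suc j) = snd (es ! j))"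
  using assms
proof (induction es arbitrary: u)
  case (Cons e es)
  then show ?case
    by (cases es) (auto simp: nth_Cons split: nat.splits)
qed simp

lemma pawalk_verts_eq_map_snd: "pawalk_verts u es = u # map snd es" if "pcas u es v"
  using that by (induction es arbitrary: u) auto

text \<open>The largest vertex of a cycle would have two different smaller neighbours on it, although its
  only smaller neighbour is its parent.\<close>

lemma parent_tree_no_cycle:
  assumes p: "\<And>i. \<lbrakk>0 < i; i < N\<rbrakk> \<Longrightarrow> p i < i"
    and cyc: "pre_digraph.cycle (with_proj (parent_tree N p)) es"
  shows "length es < 3"
proof (rule ccontr)
  define k where "k = length es"
  assume "\<not> length es < 3"
  then have k: "3 \<le> k" by (simp add: k_def)
  obtain u where arcs: "set es \<subseteq> parcs (parent_tree N p)" and cas: "pcas u es u"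
    and dist: "distinct (map snd es)"
    using cyc unfolding pre_digraph.cycle_def pre_digraph.awalk_def
    by (auto simp: cas_with_proj_eq awalk_verts_with_proj_eq pawalk_verts_eq_map_snd)
  have inj: "i = j" if "i < k" "j < k" "snd (es ! i) = snd (es ! j)" for i j
    using dist that by (auto simp: k_def distinct_conv_nth)
  define z where "z = Max (snd ` set es)"
  have "es \<noteq> []" using k by (auto simp: k_def)
  then have "z \<in> snd ` set es" unfolding z_def by (intro Max_in) auto
  then obtain j where j: "j < k" "snd (es ! j) = z"
    by (auto simp: in_set_conv_nth k_def)
  have le: "snd (es ! i) \<le> z" if "i < k" for i
    using that unfolding z_def k_def by (intro Max_ge) auto
  \<comment> \<open>\<open>i\<close> and \<open>l\<close> are the cyclic predecessor and successor
    of \<open>j\<close>: arc \<open>j\<close> enters \<open>z\<close> from the head of arc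
    \<open>i\<close>, and arc \<open>l\<close> leaves \<open>z\<close>. They differ because
    \<open>3 \<le> k\<close>.\<close>
  define i where "i = (if j = 0 then k - 1 else j - 1)"
  define l where "l = (if Suc j = k then 0 else Suc j)"
  have il: "i < k" "l < k" "i \<noteq> l"
    using j k by (auto simp: i_def l_def)
  have fj: "fst (es ! j) = snd (es ! i)"
    using pcas_nth[OF cas] j \<open>es \<noteq> []\<close> by (cases j) (auto simp: i_def k_def)
  have fl: "fst (es ! l) = z"
    using pcas_nth[OF cas] j \<open>es \<noteq> []\<close> diff_Suc_1[of j]
    by (cases "Suc j = k") (auto simp: l_def k_def simp del: diff_Suc_1)
  have "es ! j \<in> parcs (parent_tree N p)" "es ! l \<in> parcs (parent_tree N p)"
    using arcs j(1) il by (auto simp: k_def subset_eq)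
  then have "(snd (es ! i), z) \<in> parcs (parent_tree N p)"
    "(z, snd (es ! l)) \<in> parcs (parent_tree N p)"
    using fj fl j by (metis prod.collapse)+
  then have "snd (es ! i) = p z" "snd (es ! l) = p z"
    using le[OF il(1)] le[OF il(2)] p[of "snd (es ! i)"] p[of "snd (es ! l)"]
    by (auto simp: parent_tree_def)
  then show False
    using inj[of i l] il by simp
qed

text \<open>Walking up parents from a node of \<open>S\<close> stays in \<open>S\<close> and
  decreases the number until it stops at \<open>t\<close>. Reachability is shown in the symmetric
  closure, through which connectedness is defined.\<close>

lemma connected_parent_tree_induce:
  assumes p: "\<And>i. \<lbrakk>0 < i; i < N\<rbrakk> \<Longrightarrow> p i < i"
    and S: "S \<subseteq> {..<N}" and t: "t \<in> S"
    and up: "\<And>i. \<lbrakk>i \<in> S; i \<noteq> t\<rbrakk> \<Longrightarrow> 0 < i \<and> p i \<in> S"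
  shows "Digraph_Component.connected (with_proj (parent_tree N p) \<restriction> S)"
proof -
  let ?H = "mk_symmetric (with_proj (parent_tree N p) \<restriction> S)"
  have arc: "(i, p i) \<in> parcs ?H \<and> (p i, i) \<in> parcs ?H" if "i \<in> S" "i \<noteq> t" for i
  proof -
    have "(i, p i) \<in> parcs (parent_tree N p)" "p i \<in> S"
      using up[OF that] that S by (auto simp: parent_tree_def)
    then show ?thesis
      using that by (force simp: mk_symmetric_def induce_subgraph_def)
  qed
  have wf: "wf_digraph (with_proj ?H)"
    unfolding wf_digraph_wp_iff
    by unfold_locales (auto simp: mk_symmetric_def induce_subgraph_def)
  have verts: "pverts ?H = S"
    by (simp add: mk_symmetric_def)
  interpret H: wf_digraph "with_proj ?H" by (rule wf)
  have "i \<rightarrow>\<^sup>*\<^bsub>with_proj ?H\<^esub> t \<and> t \<rightarrow>\<^sup>*\<^bsub>with_proj ?H\<^esub> i" if "i \<in> S" for i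
    using that
  proof (induction i rule: less_induct)
    case (less i)
    show ?case
    proof (cases "i = t")
      case True
      then show ?thesis using t verts by simp
    next
      case False
      then have "p i < i" "p i \<in> S"
        using up[OF less.prems] p S less.prems by auto
      then have "p i \<rightarrow>\<^sup>*\<^bsub>with_proj ?H\<^esub> t \<and> t \<rightarrow>\<^sup>*\<^bsub>with_proj ?H\<^esub> p i"
        by (rule less.IH)
      then show ?thesis
        using arc[OF less.prems False]
        by (metis H.adj_reachable_trans H.reachable_adj_trans with_proj_simps(3))
    qed
  qed
  then have "i \<rightarrow>\<^sup>*\<^bsub>with_proj ?H\<^esub> j" if "i \<in> S" "j \<in> S" for i j
    using that H.reachable_trans by blast
  then show ?thesis
    unfolding Digraph_Component.connected_def using verts t by (auto intro: strongly_connectedI)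
qed

lemma undirected_tree_parent_tree:
  assumes "0 < N" and p: "\<And>i. \<lbrakk>0 < i; i < N\<rbrakk> \<Longrightarrow> p i < i"
  shows "undirected_tree (parent_tree N p)"
proof -
  have "with_proj (parent_tree N p) \<restriction> {..<N} = with_proj (parent_tree N p)"
    by (auto simp: induce_subgraph_def parent_tree_def with_proj_def)
  moreover have "Digraph_Component.connected (with_proj (parent_tree N p) \<restriction> {..<N})"
    using \<open>0 < N\<close> p less_trans
    by (intro connected_parent_tree_induce[where t = 0]) (blast | simp)+
  ultimately show ?thesis
    unfolding undirected_tree_def
    using pair_graph_parent_tree[OF p] parent_tree_no_cycle[OF p] by (metis not_less)
qed


section \<open>Tree decompositions from splits with small boundary\<close>

definition boundary :: "'a rel \<Rightarrow> 'a set \<Rightarrow> 'a set" where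
  "boundary E U = {v \<in> U. \<exists>w. w \<notin> U \<and> (v, w) \<in> E}"

text \<open>The nodes are \<open>{M..<N}\<close> with root \<open>M\<close> and parents \<open>p\<close>; an arbitrary first node \<open>M\<close> lets two
  decompositions on adjacent intervals be joined without renumbering. The node \<open>t\<close> is the topmost one
  whose bag contains \<open>v\<close>.\<close>

definition rooted_decomposition ::
    "'a rel \<Rightarrow> 'a set \<Rightarrow> nat \<Rightarrow> nat \<Rightarrow> (nat \<Rightarrow> nat) \<Rightarrow> (nat \<Rightarrow> 'a set) \<Rightarrow> bool" where
  "rooted_decomposition E U M N p bag \<longleftrightarrow>
     M < N \<and> (\<forall>i\<in>{M<..<N}. M \<le> p i \<and> p i < i) \<and>
     (\<Union>i\<in>{M..<N}. bag i) = U \<and>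
     (\<forall>u\<in>U. \<forall>v\<in>U. (u, v) \<in> E \<longrightarrow> (\<exists>i\<in>{M..<N}. u \<in> bag i \<and> v \<in> bag i)) \<and>
     (\<forall>v\<in>U. \<exists>t\<in>{M..<N}. v \<in> bag t \<and> (\<forall>i\<in>{M..<N} - {t}. v \<in> bag i \<longrightarrow> M < i \<and> v \<in> bag (p i))) \<and>
     boundary E U \<subseteq> bag M"

lemma rooted_decomposition_topE:
  assumes "rooted_decomposition E U M N p bag" "v \<in> U"
  obtains t where "t \<in> {M..<N}" "v \<in> bag t"
    "\<forall>i\<in>{M..<N} - {t}. v \<in> bag i \<longrightarrow> M < i \<and> v \<in> bag (p i)"
  using assms unfolding rooted_decomposition_def by blast

lemma rooted_decomposition_singleton: "rooted_decomposition E {v} M (Suc M) p (\<lambda>_. {v})"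
  by (auto simp: rooted_decomposition_def boundary_def)

text \<open>A new root \<open>M\<close> carries both boundaries, and the old roots
  \<open>Suc M\<close> and \<open>N1\<close> become its children. An edge between \<open>U1\<close>
  and \<open>U2\<close> has both ends in the boundaries, hence in the new bag. A boundary vertex
  already lies in the bag of its old root, so adding \<open>M\<close> keeps its nodes
  connected.\<close>

lemma rooted_decomposition_combine:
  assumes D1: "rooted_decomposition E U1 (Suc M) N1 p1 b1"
    and D2: "rooted_decomposition E U2 N1 N2 p2 b2"
    and disj: "U1 \<inter> U2 = {}" and E: "sym E"
  shows "rooted_decomposition E (U1 \<union> U2) M N2
    (\<lambda>i. if i = Suc M \<or> i = N1 then M else if i < N1 then p1 i else p2 i)
    (\<lambda>i. if i = M then boundary E U1 \<union> boundary E U2 else if i < N1 then b1 i else b2 i)"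
    (is "rooted_decomposition E ?U M N2 ?p ?b")
proof -
  define p where "p = ?p"
  define b where "b = ?b"
  have less: "Suc M < N1" "N1 < N2" and p1: "\<And>i. \<lbrakk>Suc M < i; i < N1\<rbrakk> \<Longrightarrow> Suc M \<le> p1 i \<and> p1 i < i"
    and p2: "\<And>i. \<lbrakk>N1 < i; i < N2\<rbrakk> \<Longrightarrow> N1 \<le> p2 i \<and> p2 i < i"
    and U1: "(\<Union>i\<in>{Suc M..<N1}. b1 i) = U1" and U2: "(\<Union>i\<in>{N1..<N2}. b2 i) = U2"
    using D1 D2 by (auto simp: rooted_decomposition_def)
  have sub: "boundary E U1 \<subseteq> U1" "boundary E U2 \<subseteq> U2"
    by (auto simp: boundary_def)
  have bM: "b M = boundary E U1 \<union> boundary E U2"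
    by (simp add: b_def)
  have b1: "b i = b1 i" if "i \<in> {Suc M..<N1}" for i using that by (auto simp: b_def)
  have b2: "b i = b2 i" if "i \<in> {N1..<N2}" for i using that less by (auto simp: b_def)
  have pM: "p (Suc M) = M" "p N1 = M"
    by (auto simp: p_def)
  have pp1: "p i = p1 i" if "i \<in> {Suc M<..<N1}" for i using that by (auto simp: p_def)
  have pp2: "p i = p2 i" if "i \<in> {N1<..<N2}" for i using that less by (auto simp: p_def)
  have nodes: "{M..<N2} = insert M ({Suc M..<N1} \<union> {N1..<N2})"
    using less by auto
  have "(\<Union>i\<in>{M..<N2}. b i) = b M \<union> (\<Union>i\<in>{Suc M..<N1}. b i) \<union> (\<Union>i\<in>{N1..<N2}. b i)"
    unfolding nodes by blast
  also have "\<dots> = ?U"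
    using U1 U2 b1 b2 sub bM by auto
  finally have union: "(\<Union>i\<in>{M..<N2}. b i) = ?U" .
  have edges: "\<exists>i\<in>{M..<N2}. u \<in> b i \<and> v \<in> b i" if uv: "u \<in> ?U" "v \<in> ?U" "(u, v) \<in> E" for u v
  proof -
    have vu: "(v, u) \<in> E" using uv(3) E by (auto dest: symD)
    consider "u \<in> U1" "v \<in> U1" | "u \<in> U2" "v \<in> U2" | "u \<in> b M" "v \<in> b M"
      using uv vu disj unfolding bM by (fastforce simp: boundary_def)
    then show ?thesis
    proof cases
      case 1
      then obtain i where "i \<in> {Suc M..<N1}" "u \<in> b1 i" "v \<in> b1 i"
        using D1 uv(3) unfolding rooted_decomposition_def by meson
      then show ?thesis using b1 nodes by blast
    next
      case 2
      then obtain i where "i \<in> {N1..<N2}" "u \<in> b2 i" "v \<in> b2 i"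
        using D2 uv(3) unfolding rooted_decomposition_def by meson
      then show ?thesis using b2 nodes by blast
    next
      case 3
      then show ?thesis using less by (intro bexI[of _ M]) auto
    qed
  qed
  \<comment> \<open>Stated for an arbitrary block \<open>{R..<N}\<close> hung below
    \<open>M\<close>, so that it serves both children; \<open>out\<close> says that \<open>v\<close>
    does not occur in the other block.\<close>
  have tops: "\<exists>t\<in>{M..<N2}. v \<in> b t \<and> (\<forall>i\<in>{M..<N2} - {t}. v \<in> b i \<longrightarrow> M < i \<and> v \<in> b (p i))"
    if D: "rooted_decomposition E U R N q c" and v: "v \<in> U" and R: "M < R" "N \<le> N2" "p R = M"
      and c: "\<And>i. i \<in> {R..<N} \<Longrightarrow> b i = c i" and q: "\<And>i. i \<in> {R<..<N} \<Longrightarrow> p i = q i"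
      and out: "\<And>i. \<lbrakk>i \<in> {M<..<N2}; i \<notin> {R..<N}\<rbrakk> \<Longrightarrow> v \<notin> b i"
      and vbd: "v \<in> b M \<longleftrightarrow> v \<in> boundary E U" for v U R N q c
  proof -
    obtain t where t: "t \<in> {R..<N}" "v \<in> c t"
      and up: "\<forall>i\<in>{R..<N} - {t}. v \<in> c i \<longrightarrow> R < i \<and> v \<in> c (q i)"
      by (rule rooted_decomposition_topE[OF D v])
    have step: "v \<in> b (p i)" if i: "i \<in> {R..<N} - {t}" "v \<in> b i" for i
    proof -
      have "R < i" "v \<in> c (q i)" using up c[of i] i by auto
      moreover have "q i \<in> {R..<N}"
      proof -
        have "\<forall>i\<in>{R<..<N}. R \<le> q i \<and> q i < i"
          using D unfolding rooted_decomposition_def by blast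
        then have "R \<le> q i \<and> q i < i" using \<open>R < i\<close> i by simp
        then show ?thesis using i by simp
      qed
      ultimately show ?thesis using c[of "q i"] q[of i] i by simp
    qed
    show ?thesis
    proof (cases "v \<in> boundary E U")
      case True
      then have "v \<in> c R" "R < N" using D by (auto simp: rooted_decomposition_def)
      \<comment> \<open>A boundary vertex lies in the bag of \<open>R\<close>. Any node with
        \<open>v\<close> other than the top one would have a number above \<open>R\<close>, so the
        top one is \<open>R\<close>, and \<open>M\<close> now takes its place.\<close>
      then have "t = R" using up by (metis Diff_iff atLeastLessThan_iff le_refl less_irrefl singletonD)
      then have "v \<in> b (p i)" if "i \<in> {M<..<N2}" "v \<in> b i" for i
        using that step[of i] out[of i] R True vbd by blast
      then show ?thesis using True R vbd t by (intro bexI[of _ M]) auto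
    next
      case False
      then have "M < i \<and> v \<in> b (p i)" if "i \<in> {M..<N2} - {t}" "v \<in> b i" for i
        using that step[of i] out[of i] vbd by (cases "i = M") auto
      then show ?thesis using t R c[of t] by (intro bexI[of _ t]) auto
    qed
  qed
  have "\<exists>t\<in>{M..<N2}. v \<in> b t \<and> (\<forall>i\<in>{M..<N2} - {t}. v \<in> b i \<longrightarrow> M < i \<and> v \<in> b (p i))"
    if "v \<in> ?U" for v
    using that
  proof
    assume v: "v \<in> U1"
    have "v \<notin> b i" if "i \<in> {M<..<N2}" "i \<notin> {Suc M..<N1}" for i
    proof -
      have "i \<in> {N1..<N2}" using that by auto
      then show ?thesis using b2[of i] U2 v disj by blast
    qed
    moreover have "v \<in> b M \<longleftrightarrow> v \<in> boundary E U1"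
      using v disj sub bM by auto
    ultimately show ?thesis
      using tops[OF D1 v _ _ pM(1) b1 pp1] less by simp
  next
    assume v: "v \<in> U2"
    have "v \<notin> b i" if "i \<in> {M<..<N2}" "i \<notin> {N1..<N2}" for i
    proof -
      have "i \<in> {Suc M..<N1}" using that by auto
      then show ?thesis using b1[of i] U1 v disj by blast
    qed
    moreover have "v \<in> b M \<longleftrightarrow> v \<in> boundary E U2"
      using v disj sub bM by auto
    ultimately show ?thesis
      using tops[OF D2 v _ _ pM(2) b2 pp2] less by simp
  qed
  moreover have "M \<le> p i \<and> p i < i" if "i \<in> {M<..<N2}" for i
  proof -
    consider "i = Suc M" | "i = N1" | "i \<in> {Suc M<..<N1}" | "i \<in> {N1<..<N2}"
      using \<open>i \<in> {M<..<N2}\<close> by fastforce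
    then show ?thesis
      using pM pp1[of i] pp2[of i] p1[of i] p2[of i] less by cases auto
  qed
  moreover have "boundary E ?U \<subseteq> b M"
    unfolding bM by (auto simp: boundary_def)
  moreover have "M < N2" using less by simp
  ultimately have "rooted_decomposition E ?U M N2 p b"
    unfolding rooted_decomposition_def using union edges by blast
  then show ?thesis by (simp only: p_def b_def)
qed

text \<open>Split recursively down to single vertices. A leaf bag has one element, an inner bag is a
  union of two boundaries, whence \<open>max 1 (2 * k)\<close>. The first node is arbitrary in the
  induction because the second subtree is numbered from where the first ends.\<close>

lemma ex_rooted_decomposition:
  assumes E: "sym E" and V: "finite V"
    and split: "\<And>U. \<lbrakk>U \<subseteq> V; 2 \<le> card U; card (boundary E U) \<le> k\<rbrakk> \<Longrightarrow>
      \<exists>U1 U2. U1 \<noteq> {} \<and> U2 \<noteq> {} \<and> U1 \<inter> U2 = {} \<and> U1 \<union> U2 = U \<and>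
        card (boundary E U1) \<le> k \<and> card (boundary E U2) \<le> k"
    and U: "U \<subseteq> V" "U \<noteq> {}" "card (boundary E U) \<le> k"
  shows "\<exists>N p bag. rooted_decomposition E U M N p bag \<and> (\<forall>i\<in>{M..<N}. card (bag i) \<le> max 1 (2 * k))"
  using U
proof (induction "card U" arbitrary: U M rule: less_induct)
  case less
  have fin: "finite U" using less.prems V finite_subset by blast
  show ?case
  proof (cases "2 \<le> card U")
    case True
    then obtain U1 U2 where *: "U1 \<noteq> {}" "U2 \<noteq> {}" "U1 \<inter> U2 = {}" "U1 \<union> U2 = U"
      "card (boundary E U1) \<le> k" "card (boundary E U2) \<le> k"
      using split[OF less.prems(1)] less.prems(3) by blast
    have sub: "U1 \<subseteq> V" "U2 \<subseteq> V" using * less.prems by auto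
    have "U1 \<subset> U" "U2 \<subset> U" using * by auto
    then have lt: "card U1 < card U" "card U2 < card U"
      using fin by (auto intro: psubset_card_mono)
    obtain N1 p1 b1 where D1: "rooted_decomposition E U1 (Suc M) N1 p1 b1"
      and w1: "\<forall>i\<in>{Suc M..<N1}. card (b1 i) \<le> max 1 (2 * k)"
      using less.hyps[OF lt(1) sub(1) *(1) *(5)] by blast
    obtain N2 p2 b2 where D2: "rooted_decomposition E U2 N1 N2 p2 b2"
      and w2: "\<forall>i\<in>{N1..<N2}. card (b2 i) \<le> max 1 (2 * k)"
      using less.hyps[OF lt(2) sub(2) *(2) *(6)] by blast
    let ?b = "\<lambda>i. if i = M then boundary E U1 \<union> boundary E U2 else if i < N1 then b1 i else b2 i"
    have "card (boundary E U1 \<union> boundary E U2) \<le> 2 * k"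
      using card_Un_le[of "boundary E U1" "boundary E U2"] *(5,6) by linarith
    then have "\<forall>i\<in>{M..<N2}. card (?b i) \<le> max 1 (2 * k)"
      using w1 w2 by auto
    then show ?thesis
      using rooted_decomposition_combine[OF D1 D2 *(3) E] *(4) by blast
  next
    case False
    moreover have "card U \<noteq> 0" using fin less.prems(2) by simp
    ultimately have "card U = 1" by linarith
    then obtain v where "U = {v}" by (auto simp: card_1_singleton_iff)
    then have "rooted_decomposition E U M (Suc M) id (\<lambda>_. {v})"
      using rooted_decomposition_singleton by simp
    moreover have "\<forall>i\<in>{M..<Suc M}. card {v} \<le> max 1 (2 * k)"
      by simp
    ultimately show ?thesis by blast
  qed
qed

lemma tree_decomposition_parent_tree:
  assumes D: "rooted_decomposition (parcs G) (pverts G) 0 N p bag"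
    and wf: "pair_wf_digraph G"
  shows "tree_decomposition G (parent_tree N p) bag"
proof -
  interpret pair_wf_digraph G by (rule wf)
  have N: "0 < N" and p: "\<And>i. \<lbrakk>0 < i; i < N\<rbrakk> \<Longrightarrow> p i < i"
    using D by (auto simp: rooted_decomposition_def)
  have verts: "pverts (parent_tree N p) = {0..<N}"
    by (auto simp: parent_tree_def)
  have conn: "Digraph_Component.connected
      (with_proj (parent_tree N p) \<restriction> {t \<in> pverts (parent_tree N p). v \<in> bag t})"
    if v: "v \<in> pverts G" for v
  proof -
    obtain t where t: "t \<in> {0..<N}" "v \<in> bag t"
      and up: "\<forall>i\<in>{0..<N} - {t}. v \<in> bag i \<longrightarrow> 0 < i \<and> v \<in> bag (p i)"
      by (rule rooted_decomposition_topE[OF D v])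
    show ?thesis
    proof (rule connected_parent_tree_induce[OF p])
      fix i assume "i \<in> {t \<in> pverts (parent_tree N p). v \<in> bag t}" "i \<noteq> t"
      then show "0 < i \<and> p i \<in> {t \<in> pverts (parent_tree N p). v \<in> bag t}"
        using up p[of i] verts by auto
    qed (use t verts in auto)
  qed
  have "\<exists>i\<in>{0..<N}. u \<in> bag i \<and> v \<in> bag i" if "(u, v) \<in> parcs G" for u v
    using D that in_arcsD1[OF that] in_arcsD2[OF that] unfolding rooted_decomposition_def by meson
  moreover have "(\<Union>i\<in>{0..<N}. bag i) = pverts G"
    using D by (simp add: rooted_decomposition_def)
  ultimately show ?thesis
    unfolding tree_decomposition_def
    using undirected_tree_parent_tree[OF N p] conn by (auto simp: verts)
qed

text \<open>The recursion starts at the whole vertex set, whose boundary is empty. The 1 subtracted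
  in the width absorbs the single-vertex bags, so the bound also holds for
  \<open>k = 0\<close>.\<close>

lemma treewidth_le_boundary_split:
  fixes G :: "'a pair_pre_digraph"
  assumes G: "pair_graph G" and "pverts G \<noteq> {}"
    and split: "\<And>U. \<lbrakk>U \<subseteq> pverts G; 2 \<le> card U; card (boundary (parcs G) U) \<le> k\<rbrakk> \<Longrightarrow>
      \<exists>U1 U2. U1 \<noteq> {} \<and> U2 \<noteq> {} \<and> U1 \<inter> U2 = {} \<and> U1 \<union> U2 = U \<and>
        card (boundary (parcs G) U1) \<le> k \<and> card (boundary (parcs G) U2) \<le> k"
  shows "treewidth G \<le> 2 * k"
proof -
  interpret pair_graph G by (rule G)
  have "sym (parcs G)" using arcs_symmetric by (auto simp: sym_def)
  moreover have "boundary (parcs G) (pverts G) = {}"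
    using in_arcsD2 by (auto simp: boundary_def)
  ultimately obtain N p bag where D: "rooted_decomposition (parcs G) (pverts G) 0 N p bag"
    and le: "\<forall>i\<in>{0..<N}. card (bag i) \<le> max 1 (2 * k)"
    using ex_rooted_decomposition[OF _ pair_finite_verts split] \<open>pverts G \<noteq> {}\<close>
    by (metis card.empty le0 order_refl)
  have "decomposition_width (parent_tree N p) bag
      \<in> {decomposition_width T bag | (T :: nat pair_pre_digraph) bag. tree_decomposition G T bag}"
    using tree_decomposition_parent_tree[OF D] by blast
  then have "treewidth G \<le> decomposition_width (parent_tree N p) bag"
    unfolding treewidth_def by (rule cInf_lower) simp
  also have "\<dots> \<le> max 1 (2 * k) - 1"
    unfolding decomposition_width_def using D le
    by (intro diff_le_mono Max.boundedI) (auto simp: parent_tree_def rooted_decomposition_def)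
  finally show ?thesis by linarith
qed


section \<open>Partition sequences of small stretch\<close>

text \<open>Symmetric in \<open>x\<close> and \<open>y\<close>, so that an edge spans an interval
  without its ends being put in order first.\<close>

definition between :: "'a rel \<Rightarrow> 'a \<Rightarrow> 'a \<Rightarrow> 'a set" where
  "between r x y = {v. (x, v) \<in> r \<and> (v, y) \<in> r \<or> (y, v) \<in> r \<and> (v, x) \<in> r}"

section \<open>Extrema and spans in a linear order\<close>

lemma linear_order_on_ex_least:
  assumes "linear_order_on V r" "finite X" "X \<noteq> {}" "X \<subseteq> V"
  shows "\<exists>a\<in>X. \<forall>x\<in>X. (a, x) \<in> r"
  using assms(2-4)
proof (induction X rule: finite_ne_induct)
  case (singleton x)
  then show ?case using assms(1)
    by (auto simp: order_on_defs refl_on_def)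
next
  case (insert x X)
  then obtain a where a: "a \<in> X" "\<forall>y\<in>X. (a, y) \<in> r" by auto
  have lin: "refl_on V r" "trans r" "total_on V r"
    using assms(1) by (auto simp: order_on_defs)
  have "(x, a) \<in> r \<or> (a, x) \<in> r"
    using lin insert.prems a(1) unfolding refl_on_def total_on_def by (metis insert_subset subsetD)
  moreover have "(x, x) \<in> r" using lin insert.prems by (auto simp: refl_on_def)
  ultimately show ?case using a lin(2) by (auto dest: transD)
qed

lemma between_subset_order_span:
  assumes r: "linear_order_on V r" and X: "finite X" "X \<subseteq> V" "x \<in> X" "y \<in> X"
  shows "between r x y \<subseteq> order_span r X"
proof -
  have ne: "X \<noteq> {}" using X by auto
  obtain a where a: "a \<in> X" "\<forall>x\<in>X. (a, x) \<in> r"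
    using linear_order_on_ex_least[OF r X(1) ne X(2)] by blast
  obtain b where b: "b \<in> X" "\<forall>x\<in>X. (x, b) \<in> r"
    using linear_order_on_ex_least[OF _ X(1) ne X(2), of "r\<inverse>"] r by auto
  have "trans r" using r by (auto simp: order_on_defs)
  then have "(a, v) \<in> r \<and> (v, b) \<in> r" if "v \<in> between r x y" for v
    using that a b X(3,4) unfolding between_def by (auto dest: transD)
  then show ?thesis using a b unfolding order_span_def by blast
qed

text \<open>Makes the infimum over partition sequences range over a nonempty set. One part grows
  along an enumeration: in \<open>\<P> i\<close> the last \<open>i - 1\<close> vertices are
  singletons and all others form one part.\<close>

lemma ex_partition_sequence:
  assumes "finite (pverts G)" "pverts G \<noteq> {}"
  shows "\<exists>\<P>. partition_sequence G \<P>"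
proof -
  define n where "n = card (pverts G)"
  obtain f where f: "bij_betw f {..<n} (pverts G)"
    using ex_bij_betw_nat_finite[OF assms(1)] by (auto simp: n_def atLeast0LessThan)
  have n: "0 < n" using assms by (auto simp: n_def card_gt_0_iff)
  define \<P> where "\<P> i = insert (f ` {..n - i}) ((\<lambda>j. {f j}) ` {n - i<..<n})" for i
  have inj: "inj_on f {..<n}" and img: "f ` {..<n} = pverts G"
    using f by (auto simp: bij_betw_def)
  have "partition_on (pverts G) (\<P> i)" if i: "i \<in> {1..n}" for i
  proof (rule partition_onI)
    have "{..n - i} \<union> {n - i<..<n} = {..<n}" using i n by auto
    then show "\<Union> (\<P> i) = pverts G"
      unfolding \<P>_def img[symmetric] by (auto simp flip: image_Un)
    show "{} \<notin> \<P> i" by (auto simp: \<P>_def)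
    have ne: "f j \<noteq> f k" if "j < n" "k < n" "j \<noteq> k" for j k
      using inj that by (auto simp: inj_on_def)
    show "disjnt X Y" if "X \<in> \<P> i" "Y \<in> \<P> i" "X \<noteq> Y" for X Y
    proof -
      have cases: "Z = f ` {..n - i} \<or> (\<exists>j\<in>{n - i<..<n}. Z = {f j})" if "Z \<in> \<P> i" for Z
        using that by (auto simp: \<P>_def)
      have notin: "f j \<notin> f ` {..n - i}" if "j \<in> {n - i<..<n}" for j
      proof
        assume "f j \<in> f ` {..n - i}"
        then obtain k where "k \<le> n - i" "f j = f k" by auto
        then show False using ne[of k j] that by simp
      qed
      show ?thesis
        using cases[OF \<open>X \<in> \<P> i\<close>] cases[OF \<open>Y \<in> \<P> i\<close>] \<open>X \<noteq> Y\<close>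
        by (elim disjE bexE) (use notin in \<open>simp_all add: disjnt_insert1 disjnt_insert2\<close>)
    qed
  qed
  moreover have "\<P> n = (\<lambda>v. {v}) ` pverts G"
  proof -
    have "{..<n} = insert 0 {0<..<n}" using n by auto
    then have "(\<lambda>v. {v}) ` f ` {..<n} = \<P> n"
      by (simp add: \<P>_def image_image)
    then show ?thesis by (simp add: img)
  qed
  moreover have "\<P> 1 = {pverts G}"
  proof -
    have "{..n - 1} = {..<n}" "{n - 1<..<n} = {}" using n by auto
    then show ?thesis by (simp add: \<P>_def img)
  qed
  moreover have "\<exists>X\<in>\<P> (Suc i). \<exists>Y\<in>\<P> (Suc i).
      X \<noteq> Y \<and> \<P> i = \<P> (Suc i) - {X, Y} \<union> {X \<union> Y}" if i: "i \<in> {1..<n}" for i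
  proof -
    let ?X = "f ` {..n - Suc i}" and ?Y = "{f (n - i)}"
    have lt: "n - Suc i < n - i" "n - i < n" using i by auto
    have notin: "f j \<notin> ?X" if "n - i \<le> j" "j < n" for j
      using inj_onD[OF inj] that lt by fastforce
    have "{..n - i} = insert (n - i) {..n - Suc i}" "{n - Suc i<..<n} = insert (n - i) {n - i<..<n}"
      using i by auto
    then have P: "f ` {..n - i} = ?X \<union> ?Y"
      "\<P> (Suc i) = insert ?X (insert ?Y ((\<lambda>j. {f j}) ` {n - i<..<n}))"
      by (auto simp: \<P>_def)
    \<comment> \<open>\<open>?X\<close> can itself be a singleton, so neither merged part may
      reappear among the other singletons; otherwise removing the two would remove more.\<close>
    have "?X \<noteq> ?Y" using notin[of "n - i"] lt by auto
    moreover have "?X \<notin> (\<lambda>j. {f j}) ` {n - i<..<n}"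
    proof
      assume "?X \<in> (\<lambda>j. {f j}) ` {n - i<..<n}"
      then obtain j where "n - i < j" "j < n" "?X = {f j}" by auto
      then show False using notin[of j] by auto
    qed
    moreover have "?Y \<notin> (\<lambda>j. {f j}) ` {n - i<..<n}"
      using inj_onD[OF inj, of "n - i"] lt by auto
    ultimately have "\<P> i = \<P> (Suc i) - {?X, ?Y} \<union> {?X \<union> ?Y}"
      unfolding P(2) by (auto simp: \<P>_def P(1))
    moreover have "?X \<in> \<P> (Suc i)" "?Y \<in> \<P> (Suc i)" by (simp_all add: P(2))
    ultimately show ?thesis using \<open>?X \<noteq> ?Y\<close> by (intro bexI conjI)
  qed
  ultimately have "partition_sequence G \<P>"
    by (simp add: partition_sequence_def n_def)
  then show ?thesis by blast
qed

text \<open>Both infima are over nonempty sets of natural numbers, hence attained, and the two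
  maxima bound the stretch of every single part.\<close>

lemma stretch_width_attained:
  assumes V: "finite (pverts G)" "pverts G \<noteq> {}"
  obtains r \<P> where "linear_order_on (pverts G) r" "partition_sequence G \<P>"
    "\<And>i X. \<lbrakk>i \<in> {1..card (pverts G)}; X \<in> \<P> i\<rbrakk> \<Longrightarrow> part_stretch G r (\<P> i) X \<le> stretch_width G"
proof -
  let ?n = "card (pverts G)"
  have "\<exists>r. linear_order_on (pverts G) r"
    using well_order_on[of "pverts G"] by (auto simp: well_order_on_def)
  then have "{ordered_stretch_width G r | r. linear_order_on (pverts G) r} \<noteq> {}" by blast
  then have "stretch_width G \<in> {ordered_stretch_width G r | r. linear_order_on (pverts G) r}"
    unfolding stretch_width_def by (rule Inf_nat_def1)
  then obtain r where r: "linear_order_on (pverts G) r" "stretch_width G = ordered_stretch_width G r"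
    by blast
  have "{Max ((\<lambda>i. partition_stretch G r (\<P> i)) ` {1..?n}) | \<P>. partition_sequence G \<P>} \<noteq> {}"
    using ex_partition_sequence[OF V] by blast
  then have "ordered_stretch_width G r
      \<in> {Max ((\<lambda>i. partition_stretch G r (\<P> i)) ` {1..?n}) | \<P>. partition_sequence G \<P>}"
    unfolding ordered_stretch_width_def by (rule Inf_nat_def1)
  then obtain \<P> where P: "partition_sequence G \<P>"
    "ordered_stretch_width G r = Max ((\<lambda>i. partition_stretch G r (\<P> i)) ` {1..?n})"
    by blast
  have "part_stretch G r (\<P> i) X \<le> stretch_width G" if i: "i \<in> {1..?n}" and X: "X \<in> \<P> i" for i X
  proof -
    have "partition_on (pverts G) (\<P> i)"
      using P(1) i by (simp add: partition_sequence_def Let_def)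
    then have "finite (\<P> i)" using V(1) finite_elements by blast
    then have "part_stretch G r (\<P> i) X \<le> partition_stretch G r (\<P> i)"
      unfolding partition_stretch_def using X by simp
    also have "\<dots> \<le> stretch_width G"
      unfolding r P(2) using i by (intro Max_ge) auto
    finally show ?thesis .
  qed
  then show thesis using that r(1) P(1) by blast
qed

text \<open>The stretch is used at the first partition some part of which contains more than \<open>\<Delta>\<close> elements
  of some \<open>D \<in> \<D>\<close>. Such a part is too large to be fully joined to another one, so all its
  edges are red, and the span of its red neighbourhood covers some \<open>D' \<in> \<D>\<close>.\<close>

lemma interval_family_small:
  assumes G: "pair_graph G" and r: "linear_order_on (pverts G) r" and P: "partition_sequence G \<P>"
    and t: "\<And>i X. \<lbrakk>i \<in> {1..card (pverts G)}; X \<in> \<P> i\<rbrakk> \<Longrightarrow> part_stretch G r (\<P> i) X \<le> t"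
    and \<Delta>: "\<And>v. card {w. (v, w) \<in> parcs G} \<le> \<Delta>"
    and \<D>: "\<D> \<noteq> {}" "\<And>D. D \<in> \<D> \<Longrightarrow> D \<subseteq> pverts G"
    and nbr: "\<And>D x. \<lbrakk>D \<in> \<D>; x \<in> D\<rbrakk> \<Longrightarrow> \<exists>y. (x, y) \<in> parcs G \<and> (\<exists>D'\<in>\<D>. D' \<subseteq> between r x y)"
  shows "\<exists>D\<in>\<D>. card D \<le> 2 * \<Delta> * (t + 1)"
proof (rule ccontr)
  interpret pair_graph G by (rule G)
  assume "\<not> ?thesis"
  then have large: "2 * \<Delta> * (t + 1) < card D" if "D \<in> \<D>" for D
    using that by auto
  let ?n = "card (pverts G)"
  have part: "partition_on (pverts G) (\<P> i)" if "i \<in> {1..?n}" for i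
    using P that by (simp add: partition_sequence_def Let_def)
  obtain D0 where D0: "D0 \<in> \<D>" using \<D>(1) by blast
  then have "D0 \<noteq> {}" using large[of D0] by auto
  then obtain x0 y0 where xy0: "x0 \<in> D0" "(x0, y0) \<in> parcs G" using nbr[OF D0] by blast
  have fin_nbrs: "finite {w. (v, w) \<in> parcs G}" for v
    using in_arcsD2 pair_finite_verts by (auto intro: finite_subset[of _ "pverts G"])
  have "0 < card {w. (x0, w) \<in> parcs G}"
    using xy0 fin_nbrs by (auto simp: card_gt_0_iff)
  then have \<Delta>0: "1 \<le> \<Delta>" using \<Delta>[of x0] by linarith
  have n: "1 \<le> ?n"
    using in_arcsD1[OF xy0(2)] pair_finite_verts by (auto simp: Suc_le_eq card_gt_0_iff)
  \<comment> \<open>Sequences run from index \<open>n\<close> down to 1, so the first partition with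
    such a part is the one of largest index in \<open>I\<close>. It is not the partition into
    singletons because \<open>1 \<le> \<Delta>\<close>.\<close>
  define I where "I = {i \<in> {1..?n}. \<exists>X\<in>\<P> i. \<exists>D\<in>\<D>. \<Delta> < card (X \<inter> D)}"
  have "1 \<in> I"
  proof -
    have "\<P> 1 = {pverts G}" using P by (simp add: partition_sequence_def Let_def)
    moreover have "pverts G \<inter> D0 = D0" using \<D>(2)[OF D0] by blast
    moreover have "\<Delta> < card D0" using large[OF D0] by (auto intro: le_less_trans)
    ultimately show ?thesis using D0 n by (auto simp: I_def intro!: bexI[of _ D0])
  qed
  define i where "i = Max I"
  have "finite I" by (simp add: I_def)
  then have iI: "i \<in> I" and imax: "\<And>j. j \<in> I \<Longrightarrow> j \<le> i"
    using \<open>1 \<in> I\<close> unfolding i_def by (auto intro: Max_in)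
  then obtain X D where i: "i \<in> {1..?n}" and X: "X \<in> \<P> i" and D: "D \<in> \<D>" "\<Delta> < card (X \<inter> D)"
    by (auto simp: I_def)
  have "i \<noteq> ?n"
  proof
    assume "i = ?n"
    then have "X \<in> (\<lambda>v. {v}) ` pverts G"
      using X P by (simp add: partition_sequence_def Let_def)
    then obtain v where "X = {v}" by blast
    then have "card (X \<inter> D) \<le> 1" by (auto intro: card_mono[of "{v}", simplified])
    then show False using D \<Delta>0 by simp
  qed
  then have i': "Suc i \<in> {1..?n}" "i \<in> {1..<?n}" using i by auto
  have "Suc i \<notin> I" using imax by fastforce
  then have small: "card (Y \<inter> D') \<le> \<Delta>" if "Y \<in> \<P> (Suc i)" "D' \<in> \<D>" for Y D'
    using that i' by (auto simp: I_def not_less)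
  have "\<forall>i\<in>{1..<?n}. \<exists>X\<in>\<P> (Suc i). \<exists>Y\<in>\<P> (Suc i).
      X \<noteq> Y \<and> \<P> i = \<P> (Suc i) - {X, Y} \<union> {X \<union> Y}"
    using P unfolding partition_sequence_def Let_def by (elim conjE) assumption
  from bspec[OF this i'(2)] obtain Y Z where YZ: "Y \<in> \<P> (Suc i)" "Z \<in> \<P> (Suc i)"
    "\<P> i = \<P> (Suc i) - {Y, Z} \<union> {Y \<union> Z}"
    by (elim bexE conjE) (rule that)
  \<comment> \<open>In \<open>\<P> (Suc i)\<close> every part has at most \<open>\<Delta>\<close>
    elements of each member of \<open>\<D>\<close>, and one merge at most doubles this.\<close>
  have small2: "card (W \<inter> D') \<le> 2 * \<Delta>" if W: "W \<in> \<P> i" and D': "D' \<in> \<D>" for W D'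
  proof (cases "W = Y \<union> Z")
    case True
    then have "card (W \<inter> D') \<le> card (Y \<inter> D') + card (Z \<inter> D')"
      using card_Un_le[of "Y \<inter> D'" "Z \<inter> D'"] by (simp add: Int_Un_distrib2)
    then show ?thesis using small[OF YZ(1) D'] small[OF YZ(2) D'] by linarith
  next
    case False
    then have "W \<in> \<P> (Suc i)" using W unfolding YZ(3) by blast
    from small[OF this D'] show ?thesis by linarith
  qed
  have sub: "W \<subseteq> pverts G" if "W \<in> \<P> i" for W
    using part[OF i] that by (auto simp: partition_on_def)
  have fin: "finite W" if "W \<subseteq> pverts G" for W
    using that pair_finite_verts finite_subset by blast
  have "X \<inter> D \<noteq> {}" using D(2) by auto
  then obtain x where x: "x \<in> X" "x \<in> D" by blast
  obtain y D' where y: "(x, y) \<in> parcs G" and D': "D' \<in> \<D>" "D' \<subseteq> between r x y"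
    using nbr[OF D(1) x(2)] by blast
  have "y \<in> \<Union> (\<P> i)"
    using in_arcsD2[OF y] part[OF i] by (simp add: partition_on_def)
  then obtain W where W: "W \<in> \<P> i" "y \<in> W" by blast
  let ?N = "\<Union> (closed_neighborhood (red_graph G (\<P> i)) X)"
  \<comment> \<open>The vertex \<open>y\<close> has at most \<open>\<Delta>\<close> neighbours,
    fewer than \<open>X \<inter> D\<close> has elements, so some vertex of \<open>X\<close> is not
    adjacent to it.\<close>
  have "inhomogeneous G X W" if "W \<noteq> X"
  proof -
    have "\<exists>u\<in>X. (u, y) \<notin> parcs G"
    proof (rule ccontr)
      assume "\<not> ?thesis"
      then have "X \<inter> D \<subseteq> {w. (y, w) \<in> parcs G}" using arcs_symmetric by blast
      then have "card (X \<inter> D) \<le> card {w. (y, w) \<in> parcs G}"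
        using fin_nbrs by (rule card_mono[rotated])
      then show False using \<Delta>[of y] D(2) by linarith
    qed
    then show ?thesis using that x y W unfolding inhomogeneous_def by blast
  qed
  then have "W \<in> closed_neighborhood (red_graph G (\<P> i)) X"
    using X W by (cases "W = X") (auto simp: closed_neighborhood_def red_graph_def)
  then have N: "x \<in> ?N" "y \<in> ?N"
    using x W by (auto simp: closed_neighborhood_def)
  have Nsub: "?N \<subseteq> pverts G"
    using sub X by (auto simp: closed_neighborhood_def red_graph_def)
  have span: "D' \<subseteq> order_span r ?N"
    using D'(2) between_subset_order_span[OF r fin[OF Nsub] Nsub N] by blast
  define Q where "Q = {Y. interferes G r (\<P> i) Y X}"
  have finP: "finite (\<P> i)" using part[OF i] pair_finite_verts finite_elements by blast
  then have finQ: "finite Q" by (auto simp: Q_def interferes_def)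
  \<comment> \<open>A part that meets \<open>D'\<close> has a span meeting that of the red
    neighbourhood, so it is \<open>X\<close> or interferes with it. Hence at most
    \<open>t + 1\<close> parts, with at most \<open>2 * \<Delta>\<close> elements of
    \<open>D'\<close> each, cover \<open>D'\<close>.\<close>
  have cover: "D' \<subseteq> (\<Union>Y\<in>insert X Q. Y \<inter> D')"
  proof
    fix z assume z: "z \<in> D'"
    then have "z \<in> \<Union> (\<P> i)"
      using \<D>(2)[OF D'(1)] part[OF i] by (auto simp: partition_on_def)
    then obtain Y where Y: "Y \<in> \<P> i" "z \<in> Y" by blast
    have "(z, z) \<in> r"
      using r sub[OF Y(1)] Y(2) by (auto simp: order_on_defs refl_on_def)
    then have "z \<in> order_span r Y"
      using between_subset_order_span[OF r fin[OF sub[OF Y(1)]] sub[OF Y(1)] Y(2) Y(2)]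
      by (auto simp: between_def)
    then have "conflict r Y ?N" using span z by (auto simp: conflict_def)
    then have "Y \<in> insert X Q" using Y by (auto simp: Q_def interferes_def)
    then show "z \<in> (\<Union>Y\<in>insert X Q. Y \<inter> D')" using Y z by blast
  qed
  have QP: "insert X Q \<subseteq> \<P> i" using X by (auto simp: Q_def interferes_def)
  have "finite (\<Union>Y\<in>insert X Q. Y \<inter> D')"
    using finQ fin[OF \<D>(2)[OF D'(1)]] by simp
  then have "card D' \<le> card (\<Union>Y\<in>insert X Q. Y \<inter> D')"
    using cover by (rule card_mono)
  also have "\<dots> \<le> (\<Sum>Y\<in>insert X Q. card (Y \<inter> D'))"
    using finQ by (intro card_UN_le) auto
  also have "\<dots> \<le> (\<Sum>Y\<in>insert X Q. 2 * \<Delta>)"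
    by (intro sum_mono small2 subsetD[OF QP] D'(1))
  also have "\<dots> = card (insert X Q) * (2 * \<Delta>)" by simp
  also have "\<dots> \<le> (t + 1) * (2 * \<Delta>)"
    using t[OF i X] card_insert_le_m1[of "t + 1" Q X]
    by (intro mult_le_mono1) (simp add: Q_def part_stretch_def)
  also have "\<dots> < card D'" using large[OF D'(1)] by (simp add: algebra_simps)
  finally show False by simp
qed


section \<open>Balanced cuts of circularly ordered graphs\<close>

text \<open>Arcs are counted in one direction. For symmetric \<open>E\<close> and disjoint
  \<open>X\<close> and \<open>Y\<close> this is the number of edges between them.\<close>

definition cut_size :: "'a rel \<Rightarrow> 'a set \<Rightarrow> 'a set \<Rightarrow> nat" where
  "cut_size E X Y = card (E \<inter> X \<times> Y)"

section \<open>Elementary bounds on cut sizes\<close>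

lemma cut_size_mono:
  assumes "finite E" "X \<subseteq> X'" "Y \<subseteq> Y'"
  shows "cut_size E X Y \<le> cut_size E X' Y'"
  unfolding cut_size_def using assms by (intro card_mono) auto

lemma cut_size_commute:
  assumes "sym E"
  shows "cut_size E X Y = cut_size E Y X"
proof -
  have "E \<inter> Y \<times> X = prod.swap ` (E \<inter> X \<times> Y)"
    using assms by (force simp: sym_def)
  then show ?thesis
    by (simp add: cut_size_def card_image)
qed

lemma cut_size_Un1: "cut_size E (X \<union> X') Y \<le> cut_size E X Y + cut_size E X' Y"
  unfolding cut_size_def using card_Un_le[of "E \<inter> X \<times> Y" "E \<inter> X' \<times> Y"]
  by (simp add: Int_Un_distrib Sigma_Un_distrib1)

lemma cut_size_Un2: "cut_size E X (Y \<union> Y') \<le> cut_size E X Y + cut_size E X Y'"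
  unfolding cut_size_def using card_Un_le[of "E \<inter> X \<times> Y" "E \<inter> X \<times> Y'"]
  by (simp add: Int_Un_distrib Sigma_Un_distrib2)

text \<open>Grouping the arcs by first end turns many crossing arcs into many distinct ends.\<close>

lemma cut_size_le_degree:
  assumes E: "finite E" and \<Delta>: "\<And>v. card {w. (v, w) \<in> E} \<le> \<Delta>"
  shows "cut_size E X Y \<le> card {x \<in> X. \<exists>y\<in>Y. (x, y) \<in> E} * \<Delta>"
proof -
  let ?D = "{x \<in> X. \<exists>y\<in>Y. (x, y) \<in> E}"
  have fin: "finite {w. (v, w) \<in> E}" for v
    using finite_Image[OF E, of "{v}"] by (simp add: Image_def)
  have D: "finite ?D"
    using finite_Domain[OF E] by (rule rev_finite_subset) auto
  have "cut_size E X Y \<le> card (SIGMA v:?D. {w. (v, w) \<in> E})"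
    unfolding cut_size_def using D fin by (intro card_mono) auto
  also have "\<dots> = (\<Sum>v\<in>?D. card {w. (v, w) \<in> E})"
    using D fin by (intro card_SigmaI) auto
  also have "\<dots> \<le> card ?D * \<Delta>"
    using sum_bounded_above[of ?D "\<lambda>v. card {w. (v, w) \<in> E}" \<Delta>] \<Delta> by simp
  finally show ?thesis .
qed

lemma cut_size_singleton_le:
  assumes E: "finite E" and \<Delta>: "\<And>v. card {w. (v, w) \<in> E} \<le> \<Delta>" and "X \<subseteq> {v}"
  shows "cut_size E X Y \<le> \<Delta>"
proof -
  have "card {x \<in> X. \<exists>y\<in>Y. (x, y) \<in> E} \<le> card {v}"
    using \<open>X \<subseteq> {v}\<close> by (intro card_mono) auto
  then have "card {x \<in> X. \<exists>y\<in>Y. (x, y) \<in> E} * \<Delta> \<le> 1 * \<Delta>"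
    by (intro mult_le_mono1) simp
  then show ?thesis using cut_size_le_degree[OF E \<Delta>, of X Y] by linarith
qed

text \<open>A binary search for a point cutting the interval between \<open>A\<close> and \<open>B\<close>. Whichever half
  of the interval is given away, one of two crossing edge sets is added to the cut, and one of them
  is small.\<close>

lemma interval_bisection:
  fixes f :: "nat \<Rightarrow> 'a"
  assumes E: "finite E" "sym E" and \<Delta>: "\<And>v. card {w. (v, w) \<in> E} \<le> \<Delta>"
    and "a \<le> b" "b \<le> a + 2 ^ l"
    and cross: "\<And>a' h b'. \<lbrakk>a \<le> a'; a' \<le> h; h \<le> b'; b' \<le> b\<rbrakk> \<Longrightarrow>
      cut_size E (f ` {h..<b'}) (B \<union> f ` {a..<a'}) < m \<or>
      cut_size E (f ` {a'..<h}) (A \<union> f ` {b'..<b}) < m"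
  shows "\<exists>r\<in>{a..b}. cut_size E (A \<union> f ` {r..<b}) (B \<union> f ` {a..<r}) \<le> cut_size E A B + l * m + \<Delta>"
  using assms(4-)
proof (induction l arbitrary: a b A B)
  case 0
  \<comment> \<open>At most one vertex is left; it goes to \<open>A\<close> and costs at most
    \<open>\<Delta>\<close>.\<close>
  then have "{a..<b} \<subseteq> {a}" by auto
  then have "f ` {a..<b} \<subseteq> {f a}" by blast
  then have "cut_size E (f ` {a..<b}) B \<le> \<Delta>"
    by (rule cut_size_singleton_le[OF E(1) \<Delta>])
  then show ?case
    using cut_size_Un1[of E A "f ` {a..<b}" B] 0 by (intro bexI[of _ a]) auto
next
  case (Suc l)
  \<comment> \<open>The minimum allows for an interval shorter than \<open>2 ^ l\<close>; both
    halves have length at most \<open>2 ^ l\<close>.\<close>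
  define h where "h = min b (a + 2 ^ l)"
  have h: "a \<le> h" "h \<le> b" "h \<le> a + 2 ^ l" "b \<le> h + 2 ^ l"
    using Suc.prems(1,2) by (auto simp: h_def)
  have split: "f ` {x..<y} \<union> f ` {y..<z} = f ` {x..<z}" if "x \<le> y" "y \<le> z" for x y z
    using that by (metis image_Un ivl_disj_un_two(3))
  have "cut_size E (f ` {h..<b}) B < m \<or> cut_size E (f ` {a..<h}) A < m"
    using Suc.prems(3)[of a h b] h by simp
  then show ?case
  proof
    assume lt: "cut_size E (f ` {h..<b}) B < m"
    \<comment> \<open>The right half joins \<open>A\<close>, and the search continues in the left
      half. The crossing hypothesis already allows \<open>A\<close> and \<open>B\<close> to have
      grown by outer pieces of the interval, so it carries over.\<close>
    have "\<exists>r\<in>{a..h}. cut_size E ((A \<union> f ` {h..<b}) \<union> f ` {r..<h}) (B \<union> f ` {a..<r})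
        \<le> cut_size E (A \<union> f ` {h..<b}) B + l * m + \<Delta>"
    proof (rule Suc.IH)
      fix a' h' b' assume *: "a \<le> a'" "a' \<le> h'" "h' \<le> b'" "b' \<le> h"
      have "(A \<union> f ` {h..<b}) \<union> f ` {b'..<h} = A \<union> f ` {b'..<b}"
        using split[of b' h b] * h by auto
      then show "cut_size E (f ` {h'..<b'}) (B \<union> f ` {a..<a'}) < m \<or>
          cut_size E (f ` {a'..<h'}) (A \<union> f ` {h..<b} \<union> f ` {b'..<h}) < m"
        using Suc.prems(3)[of a' h' b'] * h by simp
    qed (use h in auto)
    then obtain r where r: "r \<in> {a..h}"
      "cut_size E ((A \<union> f ` {h..<b}) \<union> f ` {r..<h}) (B \<union> f ` {a..<r})
        \<le> cut_size E (A \<union> f ` {h..<b}) B + l * m + \<Delta>" by blast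
    moreover have "(A \<union> f ` {h..<b}) \<union> f ` {r..<h} = A \<union> f ` {r..<b}"
      using split[of r h b] r(1) h by auto
    ultimately show ?thesis
      using cut_size_Un1[of E A "f ` {h..<b}" B] lt h by (intro bexI[of _ r]) auto
  next
    assume lt: "cut_size E (f ` {a..<h}) A < m"
    have "\<exists>r\<in>{h..b}. cut_size E (A \<union> f ` {r..<b}) ((B \<union> f ` {a..<h}) \<union> f ` {h..<r})
        \<le> cut_size E A (B \<union> f ` {a..<h}) + l * m + \<Delta>"
    proof (rule Suc.IH)
      fix a' h' b' assume *: "h \<le> a'" "a' \<le> h'" "h' \<le> b'" "b' \<le> b"
      have "(B \<union> f ` {a..<h}) \<union> f ` {h..<a'} = B \<union> f ` {a..<a'}"
        using split[of a h a'] * h by auto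
      then show "cut_size E (f ` {h'..<b'}) (B \<union> f ` {a..<h} \<union> f ` {h..<a'}) < m \<or>
          cut_size E (f ` {a'..<h'}) (A \<union> f ` {b'..<b}) < m"
        using Suc.prems(3)[of a' h' b'] * h by simp
    qed (use h in auto)
    then obtain r where r: "r \<in> {h..b}"
      "cut_size E (A \<union> f ` {r..<b}) ((B \<union> f ` {a..<h}) \<union> f ` {h..<r})
        \<le> cut_size E A (B \<union> f ` {a..<h}) + l * m + \<Delta>" by blast
    moreover have "(B \<union> f ` {a..<h}) \<union> f ` {h..<r} = B \<union> f ` {a..<r}"
      using split[of a h r] r(1) h by auto
    ultimately show ?thesis
      using cut_size_Un2[of E A B "f ` {a..<h}"] lt h cut_size_commute[OF E(2), of A]
      by (intro bexI[of _ r]) auto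
  qed
qed

text \<open>The fourth arc wraps around, from \<open>d\<close> to \<open>n\<close> and on from
  \<open>0\<close> to \<open>a\<close>. The inequalities are weak so that arcs may be empty.\<close>

locale circular_order =
  fixes E :: "'a rel" and f :: "nat \<Rightarrow> 'a" and n m \<Delta> :: nat
  assumes E: "finite E" "sym E" and \<Delta>: "\<And>v. card {w. (v, w) \<in> E} \<le> \<Delta>"
    and inj: "inj_on f {..<n}"
    and cross: "\<And>a b c d. \<lbrakk>a \<le> b; b \<le> c; c \<le> d; d \<le> n\<rbrakk> \<Longrightarrow>
      cut_size E (f ` {a..<b}) (f ` {c..<d}) < m \<or>
      cut_size E (f ` {b..<c}) (f ` {d..<n} \<union> f ` {0..<a}) < m"
begin

text \<open>Bisecting \<open>[a, b)\<close> and then \<open>[c, d)\<close> costs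
  \<open>l * m + \<Delta>\<close> each, on top of the fewer than \<open>m\<close> arcs present at
  the start.\<close>

lemma ex_chord:
  assumes abcd: "a \<le> b" "b \<le> c" "c \<le> d" "d \<le> n" and l: "n \<le> 2 ^ l"
    and AB: "cut_size E (f ` {b..<c}) (f ` {d..<n} \<union> f ` {0..<a}) < m"
  shows "\<exists>r\<in>{a..b}. \<exists>s\<in>{c..d}.
    cut_size E (f ` {r..<s}) (f ` {s..<n} \<union> f ` {0..<r}) \<le> (2 * l + 1) * m + 2 * \<Delta>"
proof -
  have split: "f ` {x..<y} \<union> f ` {y..<z} = f ` {x..<z}" if "x \<le> y" "y \<le> z" for x y z
    using that by (metis image_Un ivl_disj_un_two(3))
  let ?A = "f ` {b..<c}" and ?B = "f ` {d..<n} \<union> f ` {0..<a}"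
  have "\<exists>r\<in>{a..b}. cut_size E (?A \<union> f ` {r..<b}) (?B \<union> f ` {a..<r}) \<le> cut_size E ?A ?B + l * m + \<Delta>"
  proof (rule interval_bisection[OF E \<Delta>])
    fix a' h b' assume *: "a \<le> a'" "a' \<le> h" "h \<le> b'" "b' \<le> b"
    have "?A \<union> f ` {b'..<b} = f ` {b'..<c}"
      using split[of b' b c] * abcd by auto
    moreover have "?B \<union> f ` {a..<a'} \<subseteq> f ` {c..<n} \<union> f ` {0..<a'}"
      using split[of 0 a a'] split[of c d n] * abcd by auto
    then have "cut_size E (f ` {h..<b'}) (?B \<union> f ` {a..<a'})
        \<le> cut_size E (f ` {h..<b'}) (f ` {c..<n} \<union> f ` {0..<a'})"
      by (intro cut_size_mono E) auto
    ultimately show "cut_size E (f ` {h..<b'}) (?B \<union> f ` {a..<a'}) < m \<or>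
        cut_size E (f ` {a'..<h}) (?A \<union> f ` {b'..<b}) < m"
      using cross[of a' h b' c] * abcd by auto
  qed (use abcd l in auto)
  then obtain r where r: "r \<in> {a..b}"
    "cut_size E (?A \<union> f ` {r..<b}) (?B \<union> f ` {a..<r}) \<le> cut_size E ?A ?B + l * m + \<Delta>"
    by blast
  let ?A' = "f ` {r..<c}" and ?B' = "f ` {d..<n} \<union> f ` {0..<r}"
  have "?A \<union> f ` {r..<b} = ?A'" "?B \<union> f ` {a..<r} = ?B'"
    using split[of r b c] split[of 0 a r] r(1) abcd by auto
  with r(2) AB have AB': "cut_size E ?A' ?B' \<le> (l + 1) * m + \<Delta>"
    by simp
  \<comment> \<open>Upper pieces of an interval join the first set of the bisection. Above
    \<open>[c, d)\<close> lies the outer arc, so \<open>?B'\<close> now comes first, and the cut is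
    commuted back at the end.\<close>
  have "\<exists>s\<in>{c..d}. cut_size E (?B' \<union> f ` {s..<d}) (?A' \<union> f ` {c..<s}) \<le> cut_size E ?B' ?A' + l * m + \<Delta>"
  proof (rule interval_bisection[OF E \<Delta>])
    fix c' h d' assume *: "c \<le> c'" "c' \<le> h" "h \<le> d'" "d' \<le> d"
    have "?A' \<union> f ` {c..<c'} = f ` {r..<c'}"
      using split[of r c c'] * r abcd by auto
    moreover have "?B' \<union> f ` {d'..<d} = f ` {d'..<n} \<union> f ` {0..<r}"
      using split[of d' d n] * abcd by auto
    ultimately show "cut_size E (f ` {h..<d'}) (?A' \<union> f ` {c..<c'}) < m \<or>
        cut_size E (f ` {c'..<h}) (?B' \<union> f ` {d'..<d}) < m"
      using cross[of r c' h d'] * r(1) abcd cut_size_commute[OF E(2), of "f ` {h..<d'}"] by auto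
  qed (use abcd l in auto)
  then obtain s where s: "s \<in> {c..d}"
    "cut_size E (?B' \<union> f ` {s..<d}) (?A' \<union> f ` {c..<s}) \<le> cut_size E ?B' ?A' + l * m + \<Delta>"
    by blast
  have "?A' \<union> f ` {c..<s} = f ` {r..<s}" "?B' \<union> f ` {s..<d} = f ` {s..<n} \<union> f ` {0..<r}"
    using split[of r c s] split[of s d n] s(1) r(1) abcd by auto
  with s(2) AB' have "cut_size E (f ` {r..<s}) (f ` {s..<n} \<union> f ` {0..<r})
      \<le> (2 * l + 1) * m + 2 * \<Delta>"
    using cut_size_commute[OF E(2), of ?B'] cut_size_commute[OF E(2), of "f ` {r..<s}"] by simp
  then show ?thesis using r(1) s(1) by blast
qed

lemma ex_balanced_cut:
  assumes W: "W \<subseteq> f ` {..<n}" and l: "n \<le> 2 ^ l"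
  shows "\<exists>S \<subseteq> f ` {..<n}. card W div 4 \<le> card (W \<inter> S) \<and> card W div 4 \<le> card (W - S) \<and>
    cut_size E S (f ` {..<n} - S) \<le> (2 * l + 1) * m + 2 * \<Delta>"
proof -
  define q where "q = card W div 4"
  define g where "g j = card (W \<inter> f ` {..<j})" for j
  have finW: "finite W" using W finite_subset by blast
  have gn: "g n = card W" using W by (simp add: g_def Int_absorb2)
  \<comment> \<open>The first position before which \<open>k\<close> elements of \<open>W\<close>
    lie. The count \<open>g\<close> grows by at most one per position, so it takes the value
    \<open>k\<close> exactly there.\<close>
  define p where "p k = (LEAST j. k \<le> g j)" for k
  have p_le: "p k \<le> n" and g_p: "g (p k) = k" if "k \<le> card W" for k
  proof -
    have kn: "k \<le> g n" using gn that by simp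
    then show "p k \<le> n" unfolding p_def by (rule Least_le)
    have ge: "k \<le> g (p k)" unfolding p_def using kn by (rule LeastI)
    show "g (p k) = k"
    proof (cases "p k")
      case 0
      then show ?thesis using ge by (simp add: g_def)
    next
      case (Suc j)
      then have "g j < k" using not_less_Least[of j "\<lambda>j. k \<le> g j"] by (simp add: p_def)
      moreover have "g (Suc j) \<le> g j + 1"
      proof -
        have "W \<inter> f ` {..<Suc j} \<subseteq> insert (f j) (W \<inter> f ` {..<j})"
          by (auto simp: lessThan_Suc)
        then have "g (Suc j) \<le> card (insert (f j) (W \<inter> f ` {..<j}))"
          unfolding g_def by (rule card_mono[rotated]) auto
        also have "\<dots> \<le> g j + 1" by (simp add: g_def card_insert_if)
        finally show ?thesis .
      qed
      ultimately show ?thesis using ge Suc by simp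
    qed
  qed
  have p_mono: "p k \<le> p k'" if "k \<le> k'" "k' \<le> card W" for k k'
    unfolding p_def[of k] using g_p[OF that(2)] that(1) by (intro Least_le) simp
  define p1 p2 p3 where "p1 = p q" and "p2 = p (2 * q)" and "p3 = p (3 * q)"
  have ps: "p1 \<le> p2" "p2 \<le> p3" "p3 \<le> n"
    by (auto simp: p1_def p2_def p3_def q_def intro!: p_mono p_le)
  have gs: "g p1 = q" "g p2 = 2 * q" "g p3 = 3 * q"
    by (auto simp: p1_def p2_def p3_def q_def intro!: g_p)
  have "g y \<le> g x + card (W \<inter> f ` {x..<y})" for x y
  proof -
    have "W \<inter> f ` {..<y} \<subseteq> (W \<inter> f ` {..<x}) \<union> (W \<inter> f ` {x..<y})" by force
    then have "g y \<le> card ((W \<inter> f ` {..<x}) \<union> (W \<inter> f ` {x..<y}))"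
      unfolding g_def using finW by (intro card_mono) auto
    also have "\<dots> \<le> g x + card (W \<inter> f ` {x..<y})"
      unfolding g_def by (rule card_Un_le)
    finally show ?thesis .
  qed
  from this[of p1 0] this[of p2 p1] this[of p3 p2] this[of n p3]
  have q: "q \<le> card (W \<inter> f ` {0..<p1})" "q \<le> card (W \<inter> f ` {p1..<p2})"
    "q \<le> card (W \<inter> f ` {p2..<p3})" "q \<le> card (W \<inter> f ` {p3..<n})"
    using gs gn by (auto simp: g_def q_def)
  \<comment> \<open>Balance is witnessed by an arc \<open>{x..<y}\<close> inside the chord and an
    arc \<open>Z\<close> outside it, each with a quarter of \<open>W\<close>.\<close>
  have cut: ?thesis
    if S: "r \<le> x" "x \<le> y" "y \<le> s" "s \<le> n" "q \<le> card (W \<inter> f ` {x..<y})"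
      and Z: "Z \<subseteq> {s..<n} \<union> {0..<r}" "q \<le> card (W \<inter> f ` Z)"
      and le: "cut_size E (f ` {r..<s}) (f ` {s..<n} \<union> f ` {0..<r}) \<le> (2 * l + 1) * m + 2 * \<Delta>"
    for r s x y Z
  proof (intro exI[of _ "f ` {r..<s}"] conjI)
    show "f ` {r..<s} \<subseteq> f ` {..<n}" using S by auto
    have "card (W \<inter> f ` {x..<y}) \<le> card (W \<inter> f ` {r..<s})"
      using S finW by (intro card_mono) auto
    then show "card W div 4 \<le> card (W \<inter> f ` {r..<s})"
      using S(5) by (simp add: q_def)
    have "f ` Z \<inter> f ` {r..<s} = f ` (Z \<inter> {r..<s})"
      using inj S Z(1) by (intro inj_on_image_Int[symmetric, of f "{..<n}"]) auto
    moreover have "Z \<inter> {r..<s} = {}" using Z(1) by auto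
    ultimately have "W \<inter> f ` Z \<subseteq> W - f ` {r..<s}" by auto
    then have "card (W \<inter> f ` Z) \<le> card (W - f ` {r..<s})"
      using finW by (intro card_mono) auto
    then show "card W div 4 \<le> card (W - f ` {r..<s})"
      using Z(2) by (simp add: q_def)
    have "f ` {..<n} - f ` {r..<s} \<subseteq> f ` {s..<n} \<union> f ` {0..<r}" by force
    then show "cut_size E (f ` {r..<s}) (f ` {..<n} - f ` {r..<s}) \<le> (2 * l + 1) * m + 2 * \<Delta>"
      using cut_size_mono[OF E(1) order_refl] le order_trans by blast
  qed
  \<comment> \<open>Starting at \<open>0\<close> makes the four arcs the quarters. The sparse
    opposite pair is kept and the other two arcs are shrunk; taking \<open>d = n\<close> or
    \<open>a = 0\<close> in \<open>ex_chord\<close> leaves a single quarter as the outer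
    arc.\<close>
  from cross[of 0 p1 p2 p3] ps
  consider "cut_size E (f ` {0..<p1}) (f ` {p2..<p3}) < m"
    | "cut_size E (f ` {p1..<p2}) (f ` {p3..<n}) < m"
    by auto
  then show ?thesis
  proof cases
    case 1
    then have "cut_size E (f ` {p2..<p3}) (f ` {n..<n} \<union> f ` {0..<p1}) < m"
      using cut_size_commute[OF E(2), of "f ` {p2..<p3}"] by simp
    from ex_chord[OF _ _ _ _ l this] ps
    obtain r s where "r \<in> {p1..p2}" "s \<in> {p3..n}"
      "cut_size E (f ` {r..<s}) (f ` {s..<n} \<union> f ` {0..<r}) \<le> (2 * l + 1) * m + 2 * \<Delta>"
      by auto
    then show ?thesis
      using ps q by (intro cut[of r p2 p3 s "{0..<p1}"]) auto
  next
    case 2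
    then have "cut_size E (f ` {p1..<p2}) (f ` {p3..<n} \<union> f ` {0..<0}) < m" by simp
    from ex_chord[OF _ _ _ _ l this] ps
    obtain r s where "r \<in> {0..p1}" "s \<in> {p2..p3}"
      "cut_size E (f ` {r..<s}) (f ` {s..<n} \<union> f ` {0..<r}) \<le> (2 * l + 1) * m + 2 * \<Delta>"
      by auto
    then show ?thesis
      using ps q by (intro cut[of r p1 p2 s "{p3..<n}"]) auto
  qed
qed

end


section \<open>Treewidth and stretch-width\<close>

text \<open>The number of strict predecessors is strictly increasing along the order, hence a
  bijection onto an initial segment; its inverse is the enumeration.\<close>

lemma ex_linear_order_enumeration:
  assumes r: "linear_order_on V r" and V: "finite V"
  obtains f where "bij_betw f {..<card V} V" "\<And>i j. \<lbrakk>i \<le> j; j < card V\<rbrakk> \<Longrightarrow> (f i, f j) \<in> r"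
proof -
  define pos where "pos v = card {u \<in> V. (u, v) \<in> r \<and> u \<noteq> v}" for v
  have refl: "\<And>v. v \<in> V \<Longrightarrow> (v, v) \<in> r" and "trans r" "antisym r" "total_on V r"
    using r by (auto simp: order_on_defs refl_on_def)
  have less: "pos u < pos v" if uv: "u \<in> V" "v \<in> V" "(u, v) \<in> r" "u \<noteq> v" for u v
    unfolding pos_def
  proof (intro psubset_card_mono psubsetI subsetI)
    fix x assume "x \<in> {x \<in> V. (x, u) \<in> r \<and> x \<noteq> u}"
    then show "x \<in> {x \<in> V. (x, v) \<in> r \<and> x \<noteq> v}"
      using uv transD[OF \<open>trans r\<close>] antisymD[OF \<open>antisym r\<close>] by blast
  next
    have "u \<in> {x \<in> V. (x, v) \<in> r \<and> x \<noteq> v}" using uv by simp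
    then show "{x \<in> V. (x, u) \<in> r \<and> x \<noteq> u} \<noteq> {x \<in> V. (x, v) \<in> r \<and> x \<noteq> v}" by blast
  qed (use V in auto)
  have tot: "(u, v) \<in> r \<or> (v, u) \<in> r" if "u \<in> V" "v \<in> V" for u v
    using that \<open>total_on V r\<close> refl by (cases "u = v") (auto simp: total_on_def)
  have inj: "inj_on pos V"
  proof (rule inj_onI)
    fix u v assume "u \<in> V" "v \<in> V" "pos u = pos v"
    then show "u = v" using tot[of u v] less[of u v] less[of v u] by auto
  qed
  have "pos ` V \<subseteq> {..<card V}"
  proof
    fix k assume "k \<in> pos ` V"
    then obtain v where v: "v \<in> V" "k = pos v" by blast
    have "pos v < card V"
      unfolding pos_def using V v(1) by (intro psubset_card_mono) auto
    then show "k \<in> {..<card V}" using v by simp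
  qed
  then have "pos ` V = {..<card V}"
    using card_image[OF inj] by (intro card_subset_eq) auto
  then have bij: "bij_betw pos V {..<card V}"
    using inj by (simp add: bij_betw_def)
  define f where "f = inv_into V pos"
  have f: "bij_betw f {..<card V} V"
    unfolding f_def by (rule bij_betw_inv_into[OF bij])
  have pos_f: "pos (f i) = i" and fV: "f i \<in> V" if "i < card V" for i
    using bij_betw_inv_into_right[OF bij] f that by (auto simp: f_def bij_betw_def)
  have "(f i, f j) \<in> r" if "i \<le> j" "j < card V" for i j
    using tot[of "f i" "f j"] less[of "f j" "f i"] refl pos_f[of i] pos_f[of j] fV[of i] fV[of j] that
    by (metis le_less_trans not_less)
  then show thesis using that f by blast
qed

text \<open>If both crossing edge sets were large, their end sets in the four arcs would contradict
  \<open>interval_family_small\<close>. An edge between the first and third arcs spans the second.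
  An edge between the second and fourth spans the third or the first, depending on which side of the
  wrap its end in the fourth arc lies.\<close>

lemma ex_circular_order:
  assumes G: "pair_graph G" and "pverts G \<noteq> {}"
    and \<Delta>: "\<And>v. card {w. (v, w) \<in> parcs G} \<le> \<Delta>"
  obtains f where "f ` {..<card (pverts G)} = pverts G"
    "circular_order (parcs G) f (card (pverts G)) (2 * \<Delta>\<^sup>2 * (stretch_width G + 1) + 1) \<Delta>"
proof -
  interpret pair_graph G by (rule G)
  let ?t = "stretch_width G" and ?n = "card (pverts G)"
  obtain r \<P> where r: "linear_order_on (pverts G) r" and P: "partition_sequence G \<P>"
    and t: "\<And>i X. \<lbrakk>i \<in> {1..?n}; X \<in> \<P> i\<rbrakk> \<Longrightarrow> part_stretch G r (\<P> i) X \<le> ?t"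
    using stretch_width_attained[OF pair_finite_verts \<open>pverts G \<noteq> {}\<close>] by blast
  obtain f where f: "bij_betw f {..<?n} (pverts G)" and
    mono: "\<And>i j. \<lbrakk>i \<le> j; j < ?n\<rbrakk> \<Longrightarrow> (f i, f j) \<in> r"
    using ex_linear_order_enumeration[OF r pair_finite_verts] by blast
  have btw: "f ` {a..<b} \<subseteq> between r (f i) (f j)"
    if "i < a" "b \<le> j" "j < ?n" for a b i j
    using that mono by (auto simp: between_def)
  have between_commute: "between r x y = between r y x" for x y
    by (auto simp: between_def)
  have sym: "sym (parcs G)" using arcs_symmetric by (auto simp: sym_def)
  let ?m = "2 * \<Delta>\<^sup>2 * (?t + 1) + 1"
  have "cut_size (parcs G) (f ` {a..<b}) (f ` {c..<d}) < ?m \<or>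
      cut_size (parcs G) (f ` {b..<c}) (f ` {d..<?n} \<union> f ` {0..<a}) < ?m" (is "?L \<or> ?R")
    if abcd: "a \<le> b" "b \<le> c" "c \<le> d" "d \<le> ?n" for a b c d
  proof (rule ccontr)
    assume not: "\<not> (?L \<or> ?R)"
    define ends where "ends X Y = {x \<in> X. \<exists>y\<in>Y. (x, y) \<in> parcs G}" for X Y
    let ?P = "f ` {a..<b}" and ?Q = "f ` {b..<c}" and ?R = "f ` {c..<d}"
      and ?T = "f ` {d..<?n} \<union> f ` {0..<a}"
    \<comment> \<open>The value of \<open>m\<close> comes from here: more than
      \<open>2 * \<Delta> * (?t + 1) * \<Delta>\<close> arcs need more than
      \<open>2 * \<Delta> * (?t + 1)\<close> first ends.\<close>
    have ends_large: "2 * \<Delta> * (?t + 1) < card (ends X Y)"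
      if "?m \<le> cut_size (parcs G) X Y" for X Y
    proof -
      have "?m \<le> card (ends X Y) * \<Delta>"
        using that cut_size_le_degree[OF pair_finite_arcs \<Delta>, of X Y] by (simp add: ends_def)
      then have "(2 * \<Delta> * (?t + 1)) * \<Delta> < card (ends X Y) * \<Delta>"
        by (simp add: power2_eq_square algebra_simps)
      then show ?thesis by simp
    qed
    define \<D> where "\<D> = {ends ?P ?R, ends ?R ?P, ends ?Q ?T, ends ?T ?Q}"
    have "2 * \<Delta> * (?t + 1) < card D" if "D \<in> \<D>" for D
      using that ends_large[of ?P ?R] ends_large[of ?R ?P] ends_large[of ?Q ?T] ends_large[of ?T ?Q] not
        cut_size_commute[OF sym, of ?R] cut_size_commute[OF sym, of ?T]
      by (auto simp: \<D>_def not_less)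
    moreover have "\<exists>D\<in>\<D>. card D \<le> 2 * \<Delta> * (?t + 1)"
    proof (rule interval_family_small[OF G r P t \<Delta>])
      show "\<D> \<noteq> {}" by (simp add: \<D>_def)
      have "f i \<in> pverts G" if "i < ?n" for i using f that by (auto simp: bij_betw_def)
      then show "D \<subseteq> pverts G" if "D \<in> \<D>" for D
        using that abcd by (fastforce simp: \<D>_def ends_def)
      have sub: "ends X Y \<subseteq> X" for X Y by (auto simp: ends_def)
      have PR: "ends ?Q ?T \<subseteq> between r x y" if "x \<in> ?P" "y \<in> ?R" for x y
      proof -
        obtain i j where "x = f i" "i < b" "y = f j" "c \<le> j" "j < d" using \<open>x \<in> ?P\<close> \<open>y \<in> ?R\<close> by auto
        then show ?thesis using btw[of i b c j] abcd sub[of ?Q ?T] by auto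
      qed
      have QT: "\<exists>D\<in>\<D>. D \<subseteq> between r x y" if "x \<in> ?Q" "y \<in> ?T" for x y
      proof -
        obtain i where i: "x = f i" "b \<le> i" "i < c" using \<open>x \<in> ?Q\<close> by auto
        from \<open>y \<in> ?T\<close> consider j where "y = f j" "d \<le> j" "j < ?n" | j where "y = f j" "j < a" by auto
        then show ?thesis
        proof cases
          case 1
          then have "ends ?R ?P \<subseteq> between r x y"
            using btw[of i c d j] i sub[of ?R ?P] by auto
          then show ?thesis by (auto simp: \<D>_def)
        next
          case 2
          then have "ends ?P ?R \<subseteq> between r x y"
            using btw[of j a b i] i abcd sub[of ?P ?R] between_commute[of x y] by auto
          then show ?thesis by (auto simp: \<D>_def)
        qed
      qed
      fix D x assume "D \<in> \<D>" "x \<in> D"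
      then consider y where "(x, y) \<in> parcs G" "x \<in> ?P" "y \<in> ?R" | y where "(x, y) \<in> parcs G" "x \<in> ?R" "y \<in> ?P"
        | y where "(x, y) \<in> parcs G" "x \<in> ?Q" "y \<in> ?T" | y where "(x, y) \<in> parcs G" "x \<in> ?T" "y \<in> ?Q"
        unfolding \<D>_def ends_def by blast
      then show "\<exists>y. (x, y) \<in> parcs G \<and> (\<exists>D'\<in>\<D>. D' \<subseteq> between r x y)"
      proof cases
        case 1
        moreover have "ends ?Q ?T \<in> \<D>" by (simp add: \<D>_def)
        ultimately show ?thesis using PR[of x y] by blast
      next
        case 2
        moreover have "ends ?Q ?T \<in> \<D>" by (simp add: \<D>_def)
        ultimately show ?thesis using PR[of y x] between_commute[of x y] by blast
      next
        case 3
        then show ?thesis using QT[of x y] by blast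
      next
        case 4
        then show ?thesis using QT[of y x] between_commute[of x y] by auto
      qed
    qed
    ultimately show False by force
  qed
  then have "circular_order (parcs G) f ?n ?m \<Delta>"
    using pair_finite_arcs sym \<Delta> f by unfold_locales (auto simp: bij_betw_def)
  then show thesis using that f by (auto simp: bij_betw_def)
qed

text \<open>A boundary vertex of \<open>U \<inter> S\<close> has a neighbour outside
  \<open>U\<close>, and is then an old boundary vertex, or one in \<open>U - S\<close>, and is then
  an end of a cut arc.\<close>

lemma card_boundary_inter_le:
  assumes "finite E" "E \<subseteq> V \<times> V" "finite U" "U \<subseteq> V"
  shows "card (boundary E (U \<inter> S)) \<le> card (boundary E U \<inter> S) + cut_size E S (V - S)"
proof -
  let ?C = "E \<inter> S \<times> (V - S)"
  have fin: "finite ?C" using assms(1) by blast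
  have "boundary E (U \<inter> S) \<subseteq> (boundary E U \<inter> S) \<union> fst ` ?C"
  proof
    fix v assume "v \<in> boundary E (U \<inter> S)"
    then obtain w where w: "v \<in> U" "v \<in> S" "(v, w) \<in> E" "w \<notin> U \<or> w \<notin> S"
      by (auto simp: boundary_def)
    show "v \<in> (boundary E U \<inter> S) \<union> fst ` ?C"
    proof (cases "w \<in> U")
      case True
      then have "(v, w) \<in> ?C" using w assms(2) by blast
      then show ?thesis by force
    next
      case False
      then show ?thesis using w by (auto simp: boundary_def)
    qed
  qed
  moreover have "finite (boundary E U \<inter> S)"
    using \<open>finite U\<close> by (auto simp: boundary_def)
  ultimately have "card (boundary E (U \<inter> S)) \<le> card ((boundary E U \<inter> S) \<union> fst ` ?C)"
    using fin by (intro card_mono) auto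
  also have "\<dots> \<le> card (boundary E U \<inter> S) + card (fst ` ?C)"
    by (rule card_Un_le)
  also have "\<dots> \<le> card (boundary E U \<inter> S) + cut_size E S (V - S)"
    unfolding cut_size_def using card_image_le[OF fin] by simp
  finally show ?thesis .
qed

text \<open>The split for boundaries well below the limit: taking out one vertex adds only its
  neighbours, at most \<open>\<Delta>\<close>, to the boundary of the rest.\<close>

lemma boundary_split_singleton:
  assumes E: "finite E" "sym E" and \<Delta>: "\<And>v. card {w. (v, w) \<in> E} \<le> \<Delta>"
    and U: "finite U" "2 \<le> card U" "card (boundary E U) + \<Delta> \<le> k"
  shows "\<exists>U1 U2. U1 \<noteq> {} \<and> U2 \<noteq> {} \<and> U1 \<inter> U2 = {} \<and> U1 \<union> U2 = U \<and>
    card (boundary E U1) \<le> k \<and> card (boundary E U2) \<le> k"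
proof -
  obtain v where v: "v \<in> U" using U(2) by fastforce
  have fin: "finite {w. (v, w) \<in> E}"
    using finite_Image[OF E(1), of "{v}"] by (simp add: Image_def)
  have "card (boundary E {v}) \<le> \<Delta>"
  proof (cases "boundary E {v} = {}")
    case False
    then have "{w. (v, w) \<in> E} \<noteq> {}" by (auto simp: boundary_def)
    then have "1 \<le> \<Delta>" using fin \<Delta>[of v] by (metis card_gt_0_iff le_trans less_eq_Suc_le One_nat_def)
    moreover have "card (boundary E {v}) \<le> card {v}"
      by (rule card_mono) (auto simp: boundary_def)
    ultimately show ?thesis by simp
  qed simp
  moreover have "card (boundary E (U - {v})) \<le> card (boundary E U) + \<Delta>"
  proof -
    have "boundary E (U - {v}) \<subseteq> boundary E U \<union> {w. (v, w) \<in> E}"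
      using E(2) by (auto simp: boundary_def sym_def)
    moreover have "finite (boundary E U)" using U(1) by (auto simp: boundary_def)
    ultimately have "card (boundary E (U - {v})) \<le> card (boundary E U \<union> {w. (v, w) \<in> E})"
      using fin by (intro card_mono) auto
    also have "\<dots> \<le> card (boundary E U) + card {w. (v, w) \<in> E}" by (rule card_Un_le)
    finally show ?thesis using \<Delta>[of v] by linarith
  qed
  moreover have "U - {v} \<noteq> {}"
  proof
    assume "U - {v} = {}"
    then have "U = {v}" using v by blast
    then show False using U(2) by simp
  qed
  ultimately show ?thesis using v U(3)
    by (intro exI[of _ "{v}"] exI[of _ "U - {v}"]) auto
qed

text \<open>With \<open>k = 4 * K + 3 + \<Delta>\<close>, a boundary of size at most
  \<open>4 * K + 3\<close> leaves room to split off one vertex. A larger one has at least four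
  elements, so both sides of a cut balanced for it are nonempty. Either side keeps at most
  \<open>(3 * k + 3) / 4\<close> boundary vertices and gains at most \<open>K\<close>, which is
  within \<open>k\<close> because \<open>k \<ge> 4 * K + 3\<close>.\<close>

lemma treewidth_le_of_cuts:
  fixes G :: "'a pair_pre_digraph"
  assumes G: "pair_graph G" and "pverts G \<noteq> {}"
    and \<Delta>: "\<And>v. card {w. (v, w) \<in> parcs G} \<le> \<Delta>"
    and cut: "\<And>W. W \<subseteq> pverts G \<Longrightarrow> \<exists>S \<subseteq> pverts G. card W div 4 \<le> card (W \<inter> S) \<and>
      card W div 4 \<le> card (W - S) \<and> cut_size (parcs G) S (pverts G - S) \<le> K"
  shows "treewidth G \<le> 2 * (4 * K + 3 + \<Delta>)"
proof (rule treewidth_le_boundary_split[OF G \<open>pverts G \<noteq> {}\<close>])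
  interpret pair_graph G by (rule G)
  let ?E = "parcs G" and ?V = "pverts G" and ?k = "4 * K + 3 + \<Delta>"
  have sym: "sym ?E" using arcs_symmetric by (auto simp: sym_def)
  have E: "?E \<subseteq> ?V \<times> ?V" using in_arcsD1 in_arcsD2 by auto
  fix U assume U: "U \<subseteq> ?V" "2 \<le> card U" "card (boundary ?E U) \<le> ?k"
  have finU: "finite U" using U(1) pair_finite_verts finite_subset by blast
  show "\<exists>U1 U2. U1 \<noteq> {} \<and> U2 \<noteq> {} \<and> U1 \<inter> U2 = {} \<and> U1 \<union> U2 = U \<and>
    card (boundary ?E U1) \<le> ?k \<and> card (boundary ?E U2) \<le> ?k"
  proof (cases "card (boundary ?E U) + \<Delta> \<le> ?k")
    case True
    then show ?thesis by (rule boundary_split_singleton[OF pair_finite_arcs sym \<Delta> finU U(2)])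
  next
    case False
    let ?W = "boundary ?E U"
    have WU: "?W \<subseteq> U" by (auto simp: boundary_def)
    then have finW: "finite ?W" using finU finite_subset by blast
    obtain S where S: "S \<subseteq> ?V" "card ?W div 4 \<le> card (?W \<inter> S)" "card ?W div 4 \<le> card (?W - S)"
      "cut_size ?E S (?V - S) \<le> K"
      using cut[of ?W] WU U(1) by blast
    have W4: "4 \<le> card ?W" using False by linarith
    have sum: "card (?W \<inter> S) + card (?W - S) = card ?W"
      using card_Int_Diff[OF finW] by metis
    have "0 < card (?W \<inter> S)" "0 < card (?W - S)" using S(2,3) W4 by linarith+
    then have "?W \<inter> S \<noteq> {}" "?W - S \<noteq> {}" by (metis card.empty less_irrefl)+
    then have ne: "U \<inter> S \<noteq> {}" "U - S \<noteq> {}" using WU by blast+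
    have "card (boundary ?E (U \<inter> S)) \<le> card (?W \<inter> S) + K"
      using card_boundary_inter_le[OF pair_finite_arcs E finU U(1), of S] S(4) by linarith
    moreover have "card (boundary ?E (U - S)) \<le> card (?W - S) + K"
    proof -
      have "U \<inter> (?V - S) = U - S" "?W \<inter> (?V - S) = ?W - S" "?V - (?V - S) = S"
        using U(1) WU S(1) by blast+
      then show ?thesis
        using card_boundary_inter_le[OF pair_finite_arcs E finU U(1), of "?V - S"] S(4)
          cut_size_commute[OF sym, of S] by simp
    qed
    ultimately have "card (boundary ?E (U \<inter> S)) \<le> ?k" "card (boundary ?E (U - S)) \<le> ?k"
      using sum S(2,3) U(3) by linarith+
    then show ?thesis
      using ne by (intro exI[of _ "U \<inter> S"] exI[of _ "U - S"]) auto
  qed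
qed

section \<open>Maximum degree and the final estimate\<close>

lemma degree_le_max_degree:
  assumes "pair_graph G"
  shows "card {w. (v, w) \<in> parcs G} \<le> max_degree G"
proof -
  interpret pair_graph G by (rule assms)
  have card: "card {w. (v, w) \<in> parcs G} = out_degree (with_proj G) v"
  proof -
    have "out_arcs (with_proj G) v = Pair v ` {w. (v, w) \<in> parcs G}"
      by (auto simp: out_arcs_def)
    then show ?thesis by (simp add: out_degree_def card_image inj_on_def)
  qed
  show ?thesis
  proof (cases "v \<in> pverts G")
    case True
    then show ?thesis
      unfolding card max_degree_def using pair_finite_verts by (intro Max_ge) auto
  next
    case False
    then have "{w. (v, w) \<in> parcs G} = {}" using in_arcsD1 by blast
    then show ?thesis by simp
  qed
qed

text \<open>For maximum degree 0 the claimed bound is 0, while the general estimate has positive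
  constant terms; here vertices are split off one by one with empty boundaries.\<close>

lemma treewidth_edgeless:
  assumes G: "pair_graph G" "pverts G \<noteq> {}" and "max_degree G = 0"
  shows "treewidth G = 0"
proof -
  interpret pair_graph G by (rule G)
  have sym: "sym (parcs G)" using arcs_symmetric by (auto simp: sym_def)
  have \<Delta>: "card {w. (v, w) \<in> parcs G} \<le> 0" for v
    using degree_le_max_degree[OF G(1)] assms(3) by metis
  have "treewidth G \<le> 2 * 0"
  proof (rule treewidth_le_boundary_split[OF G])
    fix U assume U: "U \<subseteq> pverts G" "2 \<le> card U" "card (boundary (parcs G) U) \<le> 0"
    then have "finite U" using pair_finite_verts finite_subset by blast
    then show "\<exists>U1 U2. U1 \<noteq> {} \<and> U2 \<noteq> {} \<and> U1 \<inter> U2 = {} \<and> U1 \<union> U2 = U \<and>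
        card (boundary (parcs G) U1) \<le> 0 \<and> card (boundary (parcs G) U2) \<le> 0"
      using U by (intro boundary_split_singleton[OF pair_finite_arcs sym \<Delta>]) auto
  qed
  then show ?thesis by simp
qed

lemma treewidth_le_stretch_width:
  fixes G :: "'a pair_pre_digraph"
  assumes G: "pair_graph G" "pverts G \<noteq> {}" and l: "card (pverts G) \<le> 2 ^ l"
  defines "\<Delta> \<equiv> max_degree G"
  shows "treewidth G \<le>
    2 * (4 * ((2 * l + 1) * (2 * \<Delta>\<^sup>2 * (stretch_width G + 1) + 1) + 2 * \<Delta>) + 3 + \<Delta>)"
proof -
  have \<Delta>: "\<And>v. card {w. (v, w) \<in> parcs G} \<le> \<Delta>"
    unfolding \<Delta>_def by (rule degree_le_max_degree[OF G(1)])
  obtain f where f: "f ` {..<card (pverts G)} = pverts G" and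
    circ: "circular_order (parcs G) f (card (pverts G)) (2 * \<Delta>\<^sup>2 * (stretch_width G + 1) + 1) \<Delta>"
    using ex_circular_order[OF G \<Delta>] by blast
  show ?thesis
    using circular_order.ex_balanced_cut[OF circ _ l] f
    by (intro treewidth_le_of_cuts[OF G \<Delta>]) simp
qed

theorem theorem5:
  "\<exists>c::real. \<forall>G :: nat pair_pre_digraph.
     pair_graph G \<and> pverts G \<noteq> {} \<longrightarrow>
     real (treewidth G)
       \<le> c * real (max_degree G) ^ 4 * real (max 1 (stretch_width G)) ^ 2
           * log 2 (real (card (pverts G)))"
proof (intro exI[of _ 224] allI impI)
  fix G :: "nat pair_pre_digraph"
  assume "pair_graph G \<and> pverts G \<noteq> {}"
  then have G: "pair_graph G" "pverts G \<noteq> {}" by auto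
  interpret pair_graph G by (rule G)
  define n where "n = card (pverts G)"
  define \<Delta> where "\<Delta> = max_degree G"
  define T where "T = max 1 (stretch_width G)"
  show "real (treewidth G)
       \<le> 224 * real (max_degree G) ^ 4 * real (max 1 (stretch_width G)) ^ 2
           * log 2 (real (card (pverts G)))"
  proof (cases "\<Delta> = 0")
    case True
    then show ?thesis using treewidth_edgeless[OF G] by (simp add: \<Delta>_def)
  next
    case False
    then have \<Delta>1: "1 \<le> real \<Delta>" by simp
    have T1: "1 \<le> real T" by (simp add: T_def)
    \<comment> \<open>An edge forces two vertices, so the logarithm is at least 1 and can absorb
      rounding and constants.\<close>
    have "n \<noteq> 1"
    proof
      assume "n = 1"
      then obtain v where v: "pverts G = {v}" by (auto simp: n_def card_1_singleton_iff)
      have "parcs G = {}"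
        using in_arcsD1 in_arcsD2 no_loops' v by (metis equals0I singletonD surj_pair)
      then have "\<Delta> = 0" by (simp add: \<Delta>_def max_degree_def v out_degree_def out_arcs_def)
      then show False using False by simp
    qed
    moreover have "n \<noteq> 0" using G(2) pair_finite_verts by (simp add: n_def)
    ultimately have n2: "2 \<le> n" by simp
    define L where "L = log 2 (real n)"
    have L1: "1 \<le> L" using n2 by (simp add: L_def le_log_iff)
    define l where "l = nat \<lceil>L\<rceil>"
    have lL: "real l \<le> 2 * L" "L \<le> real l" using L1 unfolding l_def by linarith+
    have "real n = 2 powr L" using n2 by (simp add: L_def)
    also have "\<dots> \<le> 2 powr real l" using lL by simp
    also have "\<dots> = real (2 ^ l)" by (simp add: powr_realpow)
    finally have "n \<le> 2 ^ l" by (simp only: of_nat_le_iff)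
    then have "treewidth G \<le>
        2 * (4 * ((2 * l + 1) * (2 * \<Delta>\<^sup>2 * (stretch_width G + 1) + 1) + 2 * \<Delta>) + 3 + \<Delta>)"
      using treewidth_le_stretch_width[OF G] by (simp add: n_def \<Delta>_def)
    then have "real (treewidth G) \<le>
        real (2 * (4 * ((2 * l + 1) * (2 * \<Delta>\<^sup>2 * (stretch_width G + 1) + 1) + 2 * \<Delta>) + 3 + \<Delta>))"
      by (simp only: of_nat_le_iff)
    also have "\<dots> = 8 * ((2 * real l + 1) * (2 * real \<Delta> ^ 2 * (real (stretch_width G) + 1) + 1)) + 18 * real \<Delta> + 6"
      by (simp add: algebra_simps)
    also have "\<dots> \<le> 8 * ((5 * L) * (5 * real \<Delta> ^ 2 * real T)) + 24 * real \<Delta>"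
    \<comment> \<open>The factors 5 come from \<open>l \<le> 2 * L\<close> with
      \<open>1 \<le> L\<close>, and from \<open>stretch_width G + 1 \<le> 2 * T\<close> with
      \<open>1 \<le> \<Delta>\<^sup>2 * T\<close>; the rest is
      \<open>18 * \<Delta> + 6 \<le> 24 * \<Delta>\<close>.\<close>
    proof -
      have "real (stretch_width G) + 1 \<le> 2 * real T" by (simp add: T_def)
      then have "2 * real \<Delta> ^ 2 * (real (stretch_width G) + 1) \<le> 2 * real \<Delta> ^ 2 * (2 * real T)"
        by (intro mult_left_mono) auto
      moreover have "1 * 1 \<le> real \<Delta> ^ 2 * real T"
        using \<Delta>1 T1 by (intro mult_mono) auto
      ultimately have "2 * real \<Delta> ^ 2 * (real (stretch_width G) + 1) + 1 \<le> 5 * real \<Delta> ^ 2 * real T"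
        by (simp add: algebra_simps)
      then have "(2 * real l + 1) * (2 * real \<Delta> ^ 2 * (real (stretch_width G) + 1) + 1)
          \<le> (5 * L) * (5 * real \<Delta> ^ 2 * real T)"
        using lL L1 by (intro mult_mono) auto
      then show ?thesis using \<Delta>1 by linarith
    qed
    \<comment> \<open>The constant is \<open>8 * 5 * 5 + 24\<close>. The main term is only quadratic
      in \<open>\<Delta>\<close> and linear in \<open>T\<close>; it is weakened here to the stated
      powers.\<close>
    also have "\<dots> \<le> 224 * (real \<Delta> ^ 4 * real T ^ 2 * L)"
    proof -
      have "real \<Delta> ^ 2 * real T * L \<le> real \<Delta> ^ 4 * real T ^ 2 * L"
        using \<Delta>1 T1 L1 power_increasing[of 1 2 "real T"]
        by (intro mult_mono power_increasing) auto
      moreover have "real \<Delta> * 1 * 1 \<le> real \<Delta> ^ 4 * real T ^ 2 * L"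
        using \<Delta>1 T1 L1 power_increasing[of 1 4 "real \<Delta>"] by (intro mult_mono) auto
      ultimately show ?thesis by (simp add: algebra_simps)
    qed
    finally show ?thesis by (simp add: \<Delta>_def T_def L_def n_def algebra_simps)
  qed
qed

end
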